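(* Let $P$ and $P'$ be two 3-dimensional convex 3-colorable polytopes, and let $\widetilde P$ and $\widetilde{P'}$ be the convex hulls of their respective face-vertex incident vectors. Then $\widetilde P$ and $\widetilde{P'}$ are combinatorially equivalent if and only if all of the following hold: (1) $P$ and $P'$ have the same number of faces (equivalently, of vertices, or of edges); (2) $m(P)$ and $m(P')$ have the same type; (3) $m_2(P)=m_2(P')$.
   Context: A convex polytope $P$ is 3-colorable if it is 3-dimensional and simple (each vertex belongs to exactly three 2-dimensional faces) and each facet can be assigned a color in $\{1,2,3\}$ so that adjacent facets have different colors. "Face of $P$" means 2-dimensional face. Such a $P$ has an even number $2n$ of vertices, $3n$ edges and $n+2$ faces. Identify the vertex set of $P$ with $\{1,\dots,2n\}$. For a face $f$ of $P$, $\xi_f\in\{0,1\}^{2n}\subseteq\mathbb{R}^{2n}$ (the face-vertex incident vector) has entry $1$ at $v$ if $v\in f$ and $0$ otherwise. $\widetilde P=\operatorname{conv}\{\xi_f: f\text{ a face of }P\}\subseteq\mathbb{R}^{2n}$. Fix a proper coloring of the faces of $P$ by $1,2,3$, with the colors labelled so that, with $m_i(P)$ the number of faces colored by $i$, one has $m_1(P)\le m_2(P)\le m_3(P)$; put $m(P)=(m_1(P),m_2(P),m_3(P))$. Writing $m_i=m_i(P)$, $m(P)$ has type I if $m_3>m_2>m_1\ge 2$; type II if $m_3=m_2>m_1\ge2$; type III if $m_3>m_2=m_1\ge 2$; type IV if $m_3=m_2=m_1\ge 2$. Two polytopes are combinatorially equivalent if their face lattices are isomorphic. *)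

theory Defs
  imports "HOL-Analysis.Analysis"
begin

definition facets :: "'a::euclidean_space set \<Rightarrow> 'a set set" where
  "facets P = {f. f facet_of P}"

definition edges :: "'a::euclidean_space set \<Rightarrow> 'a set set" where
  "edges P = {e. e edge_of P}"

definition vertices :: "'a::euclidean_space set \<Rightarrow> 'a set" where
  "vertices P = {v. v extreme_point_of P}"

definition simple3 :: "'a::euclidean_space set \<Rightarrow> bool" where
  "simple3 P \<longleftrightarrow> (\<forall>v\<in>vertices P. card {f\<in>facets P. v \<in> f} = 3)"

definition adjacent_facets :: "'a::euclidean_space set \<Rightarrow> 'a set \<Rightarrow> 'a set \<Rightarrow> bool" where
  "adjacent_facets P f g \<longleftrightarrow>
     f \<in> facets P \<and> g \<in> facets P \<and> f \<noteq> g \<and> (\<exists>e\<in>edges P. e \<subseteq> f \<and> e \<subseteq> g)"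

definition proper_3_coloring :: "'a::euclidean_space set \<Rightarrow> ('a set \<Rightarrow> nat) \<Rightarrow> bool" where
  "proper_3_coloring P c \<longleftrightarrow>
     (\<forall>f\<in>facets P. c f \<in> {1, 2, 3}) \<and>
     (\<forall>f g. adjacent_facets P f g \<longrightarrow> c f \<noteq> c g)"

text \<open>The polytope may sit in any Euclidean space; only its affine dimension has to be 3.\<close>

definition three_colorable :: "'a::euclidean_space set \<Rightarrow> bool" where
  "three_colorable P \<longleftrightarrow>
     polytope P \<and> aff_dim P = 3 \<and> simple3 P \<and> (\<exists>c. proper_3_coloring P c)"

definition color_count :: "'a::euclidean_space set \<Rightarrow> ('a set \<Rightarrow> nat) \<Rightarrow> nat \<Rightarrow> nat" where
  "color_count P c i = card {f\<in>facets P. c f = i}"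

definition m_vec :: "'a::euclidean_space set \<Rightarrow> ('a set \<Rightarrow> nat) \<Rightarrow> nat \<times> nat \<times> nat" where
  "m_vec P c = (color_count P c 1, color_count P c 2, color_count P c 3)"

definition ordered_coloring :: "'a::euclidean_space set \<Rightarrow> ('a set \<Rightarrow> nat) \<Rightarrow> bool" where
  "ordered_coloring P c \<longleftrightarrow>
     proper_3_coloring P c \<and>
     color_count P c 1 \<le> color_count P c 2 \<and> color_count P c 2 \<le> color_count P c 3"

datatype color_type = Type_I | Type_II | Type_III | Type_IV

fun has_type :: "nat \<times> nat \<times> nat \<Rightarrow> color_type \<Rightarrow> bool" where
  "has_type (m1, m2, m3) Type_I   \<longleftrightarrow> m3 > m2 \<and> m2 > m1 \<and> m1 \<ge> 2"
| "has_type (m1, m2, m3) Type_II  \<longleftrightarrow> m3 = m2 \<and> m2 > m1 \<and> m1 \<ge> 2"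
| "has_type (m1, m2, m3) Type_III \<longleftrightarrow> m3 > m2 \<and> m2 = m1 \<and> m1 \<ge> 2"
| "has_type (m1, m2, m3) Type_IV  \<longleftrightarrow> m3 = m2 \<and> m2 = m1 \<and> m1 \<ge> 2"

definition same_type :: "nat \<times> nat \<times> nat \<Rightarrow> nat \<times> nat \<times> nat \<Rightarrow> bool" where
  "same_type m m' \<longleftrightarrow> (\<exists>T. has_type m T \<and> has_type m' T)"

text \<open>The identification of the vertex set with \<open>{1,\<dots>,2n}\<close> is a bijection from a
  finite index type, so that the incidence vectors live in \<open>real^'n\<close> where
  \<open>CARD('n)\<close> is the number of vertices.\<close>

definition vertex_labelling :: "'a::euclidean_space set \<Rightarrow> ('n::finite \<Rightarrow> 'a) \<Rightarrow> bool" where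
  "vertex_labelling P lab \<longleftrightarrow> bij_betw lab UNIV (vertices P)"

definition incidence_vector :: "('n::finite \<Rightarrow> 'a) \<Rightarrow> 'a set \<Rightarrow> real^'n" where
  "incidence_vector lab f = (\<chi> i. if lab i \<in> f then 1 else 0)"

definition face_vertex_polytope ::
    "'a::euclidean_space set \<Rightarrow> ('n::finite \<Rightarrow> 'a) \<Rightarrow> (real^'n) set" where
  "face_vertex_polytope P lab = convex hull (incidence_vector lab ` facets P)"

text \<open>Isomorphism of face lattices. The relation \<open>face_of\<close> includes the empty face and
  the polytope itself; an order isomorphism of lattices is a lattice isomorphism.\<close>

definition combinatorially_equivalent ::
    "'a::euclidean_space set \<Rightarrow> 'b::euclidean_space set \<Rightarrow> bool" where
  "combinatorially_equivalent S T \<longleftrightarrow>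
     (\<exists>\<phi>. bij_betw \<phi> {F. F face_of S} {G. G face_of T} \<and>
          (\<forall>F F'. F face_of S \<longrightarrow> F' face_of S \<longrightarrow> (F \<subseteq> F' \<longleftrightarrow> \<phi> F \<subseteq> \<phi> F')))"

end

theory Submission
  imports Defs
begin

text \<open>
  Each vertex of \<open>P\<close> lies on exactly one facet of each colour, so for every colour the incidence
  vectors of that class sum up to the all-ones vector. These are the only sources of linear relations:
  in a relation, crossing an edge from one vertex to the next replaces a facet by another one of the same
  colour with the same coefficient, and the graph of \<open>P\<close> is connected, so the coefficients depend on
  the colour only (\<open>vertex_relation_constant_on_colours\<close>) and the three values add up to zero. An
  affine dependency has the additional condition \<open>m1 * b1 + m2 * b2 + m3 * b3 = 0\<close> on the class
  sizes. For sizes that are not all equal this leaves one affine circuit, with two sides; its signs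
  are determined by the order of the sizes. For equal sizes there are three mutually opposite classes.

  By Gale duality (\<open>face_lattice_of_convex_hull\<close>), the face lattice of the face-vertex polytope can be
  read off these signs: a set of facets of \<open>P\<close> spans a face iff it contains all of certain
  disjoint blocks or none of them. The blocks are the classes 2 and 3 (or 1 and 2) in type II (or III), all
  three classes in type IV, and in type I class 2 and the union of classes 1 and 3. Every class
  has at least two members, so the atoms of this lattice are the facets of \<open>P\<close> and the blocks are the
  minimal sets that do not span a face. Two such lattices are thus isomorphic iff a bijection of the facets
  matches the blocks (\<open>block_family_isomorphic_iff\<close>), and comparing block sizes gives the three
  conditions of the theorem (\<open>circuit_blocks_bijection_iff\<close>).

  The relation between the numbers of facets, vertices and edges is Euler's formula for simple
  polytopes (\<open>vertices_facets_formula\<close>, \<open>handshake\<close>). Both it and the connectedness of the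
  graph come from sweeping \<open>P\<close> by a generic linear functional, for which the local structure at
  a vertex suffices: there the polytope lies in a simplicial cone spanned by three edges, each of
  which is the intersection of two of the three facets (\<open>simple_vertex_frame\<close>).
\<close>

section \<open>Vertices of simple 3-polytopes\<close>

definition facets_at :: "'a::euclidean_space set \<Rightarrow> 'a \<Rightarrow> 'a set set" where
  "facets_at P v = {f\<in>facets P. v \<in> f}"

lemma halfspace_of_facet:
  assumes "polytope P" "f \<in> facets P"
  shows "\<exists>a b. P \<subseteq> {x. a \<bullet> x \<le> b} \<and> f = P \<inter> {x. a \<bullet> x = b}"
proof -
  have "f facet_of P" using assms(2) by (simp add: facets_def)
  then obtain a b where "P \<subseteq> {x. a \<bullet> x \<le> b}" "f = P \<inter> {x. a \<bullet> x = b}"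
    by (rule facet_of_polyhedron[OF polytope_imp_polyhedron[OF assms(1)]])
  then show ?thesis by blast
qed

text \<open>A segment from a relative interior point to a point outside the polytope leaves through some facet,
and it strictly violates the inequality of that facet from there on. The normal vectors are
arbitrary supporting ones, one per facet; this avoids having to match a minimal halfspace
representation with the facets.\<close>
lemma polytope_contains_if_facet_inequalities:
  assumes P: "polytope P" "P \<noteq> {}"
    and sub: "\<And>f. f \<in> facets P \<Longrightarrow> P \<subseteq> {x. a f \<bullet> x \<le> b f}"
    and eq: "\<And>f. f \<in> facets P \<Longrightarrow> f = P \<inter> {x. a f \<bullet> x = b f}"
    and x: "x \<in> affine hull P" and le: "\<And>f. f \<in> facets P \<Longrightarrow> a f \<bullet> x \<le> b f"
  shows "x \<in> P"
proof (rule ccontr)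
  assume nx: "x \<notin> P"
  have "convex P" "bounded P" "polyhedron P"
    using P polytope_imp_convex polytope_imp_bounded polytope_imp_polyhedron by auto
  then obtain z where z: "z \<in> rel_interior P"
    using P(2) rel_interior_eq_empty by blast
  then have zP: "z \<in> P" using rel_interior_subset by blast
  then have "x \<noteq> z" using nx by auto
  then obtain d where d: "0 < d" "z + d *\<^sub>R (x - z) \<in> rel_frontier P"
    using ray_to_rel_frontier[OF \<open>bounded P\<close> z, of "x - z"] x by auto
  then obtain f where f: "f facet_of P" "z + d *\<^sub>R (x - z) \<in> f"
    using rel_frontier_of_polyhedron[OF \<open>polyhedron P\<close>] by auto
  have ff: "f \<in> facets P" using f by (simp add: facets_def)
  have "z \<notin> f"
    using f(1) z \<open>polyhedron P\<close> rel_interior_of_polyhedron by blast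
  then have lt: "a f \<bullet> z < b f"
    using sub[OF ff] eq[OF ff] zP by force
  have yP: "z + d *\<^sub>R (x - z) \<in> P" using eq[OF ff] f by blast
  have "a f \<bullet> (z + d *\<^sub>R (x - z)) = b f" using eq[OF ff] f by blast
  then have e: "a f \<bullet> z + d * (a f \<bullet> x - a f \<bullet> z) = b f"
    by (simp add: inner_add_right inner_diff_right)
  \<comment> \<open>The ray meets the facet not earlier than at \<open>x\<close>, so \<open>x\<close> lies between two points of \<open>P\<close>.\<close>
  have "d \<ge> 1"
  proof (rule ccontr)
    assume "\<not> d \<ge> 1"
    have "d * (a f \<bullet> x - a f \<bullet> z) \<le> d * (b f - a f \<bullet> z)"
      using le[OF ff] d by (intro mult_left_mono) auto
    also have "\<dots> < 1 * (b f - a f \<bullet> z)"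
      using lt \<open>\<not> d \<ge> 1\<close> by (intro mult_strict_right_mono) auto
    finally show False using e by simp
  qed
  then have "x = (1 - 1/d) *\<^sub>R z + (1/d) *\<^sub>R (z + d *\<^sub>R (x - z))"
    using d by (simp add: algebra_simps)
  moreover have "(1 - 1/d) *\<^sub>R z + (1/d) *\<^sub>R (z + d *\<^sub>R (x - z)) \<in> P"
    using \<open>d \<ge> 1\<close> by (intro convexD[OF \<open>convex P\<close> zP yP]) auto
  ultimately show False using nx by simp
qed

text \<open>The facets missing \<open>v\<close> have slack there, and there are finitely many of them, so only the
facets through \<open>v\<close> restrict a short step.\<close>
lemma polytope_move_along_tangent:
  assumes P: "polytope P"
    and sub: "\<And>f. f \<in> facets P \<Longrightarrow> P \<subseteq> {x. a f \<bullet> x \<le> b f}"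
    and eq: "\<And>f. f \<in> facets P \<Longrightarrow> f = P \<inter> {x. a f \<bullet> x = b f}"
    and v: "v \<in> P" and d: "v + d \<in> affine hull P"
    and le: "\<And>f. f \<in> facets_at P v \<Longrightarrow> a f \<bullet> d \<le> 0"
  shows "\<exists>\<epsilon>>0. v + \<epsilon> *\<^sub>R d \<in> P"
proof -
  have fin: "finite (facets P)"
    unfolding facets_def by (rule finite_polytope_facets[OF P])
  have "\<exists>\<epsilon>>0. \<forall>f\<in>facets P. a f \<bullet> (v + \<epsilon> *\<^sub>R d) \<le> b f"
  proof -
    have ev: "\<forall>\<^sub>F \<epsilon> in at_right 0. a f \<bullet> (v + \<epsilon> *\<^sub>R d) \<le> b f" if f: "f \<in> facets P" for f
    proof (cases "v \<in> f")
      case True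
      then have "a f \<bullet> d \<le> 0" using le f by (simp add: facets_at_def)
      moreover have "a f \<bullet> v = b f" using True eq[OF f] by blast
      moreover have "\<forall>\<^sub>F \<epsilon> in at_right 0. (0::real) < \<epsilon>"
        by (simp add: eventually_at_right_less)
      ultimately show ?thesis
        by (elim eventually_mono) (auto simp: inner_add_right mult_nonneg_nonpos)
    next
      case False
      then have "a f \<bullet> v < b f"
        using sub[OF f] eq[OF f] v by force
      moreover have "((\<lambda>\<epsilon>. a f \<bullet> (v + \<epsilon> *\<^sub>R d)) \<longlongrightarrow> a f \<bullet> (v + 0 *\<^sub>R d)) (at_right 0)"
        by (intro tendsto_intros)
      ultimately have "\<forall>\<^sub>F \<epsilon> in at_right 0. a f \<bullet> (v + \<epsilon> *\<^sub>R d) < b f"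
        by (auto simp: order_tendsto_iff)
      then show ?thesis by (rule eventually_mono) simp
    qed
    have "\<forall>\<^sub>F \<epsilon> in at_right 0. 0 < \<epsilon> \<and> (\<forall>f\<in>facets P. a f \<bullet> (v + \<epsilon> *\<^sub>R d) \<le> b f)"
      by (intro eventually_conj eventually_at_right_less eventually_ball_finite fin ballI ev)
    then show ?thesis
      using eventually_happens' trivial_limit_at_right_real by (smt (verit, best))
  qed
  then obtain \<epsilon> where \<epsilon>: "\<epsilon> > 0" "\<And>f. f \<in> facets P \<Longrightarrow> a f \<bullet> (v + \<epsilon> *\<^sub>R d) \<le> b f" by auto
  have "v + \<epsilon> *\<^sub>R ((v + d) - v) \<in> affine hull P"
    by (rule mem_affine_3_minus[of "affine hull P" v "v+d" v])
       (use d v hull_inc in auto)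
  then have "v + \<epsilon> *\<^sub>R d \<in> P"
    using v polytope_contains_if_facet_inequalities[where a = a and b = b and P = P
        and x = "v + \<epsilon> *\<^sub>R d"] P sub eq \<epsilon>(2) by (metis (no_types, lifting) add_diff_cancel_left' empty_iff)
  then show ?thesis using \<epsilon>(1) by blast
qed

text \<open>Each hyperplane through the origin lowers the dimension of a subspace by at most one.\<close>
lemma exists_orthogonal_in_subspace:
  fixes L :: "'a::euclidean_space set"
  assumes "finite G" "subspace L" "card G < dim L"
  shows "\<exists>d\<in>L. d \<noteq> 0 \<and> (\<forall>g\<in>G. a g \<bullet> d = 0)"
proof -
  have "\<exists>L'. subspace L' \<and> L' \<subseteq> L \<and> dim L \<le> dim L' + card G \<and> (\<forall>d\<in>L'. \<forall>g\<in>G. a g \<bullet> d = 0)"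
    using \<open>finite G\<close>
  proof induction
    case empty
    then show ?case using assms(2) by auto
  next
    case (insert g G)
    then obtain L' where L': "subspace L'" "L' \<subseteq> L" "dim L \<le> dim L' + card G"
      "\<forall>d\<in>L'. \<forall>g\<in>G. a g \<bullet> d = 0" by auto
    let ?H = "{x. a g \<bullet> x = 0}"
    have H: "subspace ?H" by (rule subspace_hyperplane)
    have "DIM('a) \<le> dim ?H + 1"
      by (cases "a g = 0") (auto simp: dim_hyperplane)
    moreover have "dim {x + y |x y. x \<in> L' \<and> y \<in> ?H} \<le> DIM('a)" by (rule dim_subset_UNIV)
    moreover have "dim {x + y |x y. x \<in> L' \<and> y \<in> ?H} + dim (L' \<inter> ?H) = dim L' + dim ?H"
      by (rule dim_sums_Int[OF L'(1) H])
    ultimately have "dim L' \<le> dim (L' \<inter> ?H) + 1" by linarith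
    then have "dim L \<le> dim (L' \<inter> ?H) + card (insert g G)"
      using L'(3) insert by simp
    moreover have "subspace (L' \<inter> ?H)" using L'(1) H subspace_inter by blast
    ultimately show ?case using L' by (intro exI[of _ "L' \<inter> ?H"]) auto
  qed
  then obtain L' where L': "subspace L'" "L' \<subseteq> L" "dim L \<le> dim L' + card G"
    "\<forall>d\<in>L'. \<forall>g\<in>G. a g \<bullet> d = 0" by auto
  then have "dim L' \<noteq> 0" using assms(3) by linarith
  then have "\<not> L' \<subseteq> {0}" by simp
  then obtain d where "d \<in> L'" "d \<noteq> 0" by blast
  then show ?thesis using L' by (intro bexI[of _ d]) auto
qed

text \<open>At a vertex on three facets, each facet \<open>f\<close> through the vertex misses exactly one of the three
edges there, namely the intersection of the two other facets. Edges at a vertex are therefore indexed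
by facets throughout.\<close>
definition opposite_edge :: "'a::euclidean_space set \<Rightarrow> 'a \<Rightarrow> 'a set \<Rightarrow> 'a set" where
  "opposite_edge P v f = P \<inter> \<Inter>(facets_at P v - {f})"

text \<open>The local picture at a simple vertex \<open>v\<close>: \<open>n f\<close> is the other end of the edge
opposite to \<open>f\<close>, and the polytope lies in the simplicial cone at \<open>v\<close> spanned by
the three edges. The coordinate of \<open>x\<close> along the edge opposite to \<open>f\<close> measures
how far \<open>x\<close> is from \<open>f\<close>.\<close>
definition vertex_frame :: "'a::euclidean_space set \<Rightarrow> 'a \<Rightarrow> ('a set \<Rightarrow> 'a) \<Rightarrow> bool" where
  "vertex_frame P v n \<longleftrightarrow>
     (\<forall>f\<in>facets_at P v. n f \<in> vertices P \<and> n f \<noteq> v \<and> n f \<notin> f \<and>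
        opposite_edge P v f \<in> edges P \<and> opposite_edge P v f = closed_segment v (n f)) \<and>
     (\<forall>x\<in>P. \<exists>t. (\<forall>f\<in>facets_at P v. t f \<ge> 0 \<and> (x \<in> f \<longleftrightarrow> t f = 0)) \<and>
        x = v + (\<Sum>f\<in>facets_at P v. t f *\<^sub>R (n f - v)))"

lemma edge_is_segment:
  assumes "polytope P" "e \<in> edges P"
  obtains u w where "u \<noteq> w" "e = closed_segment u w" "u \<in> vertices P" "w \<in> vertices P"
    "vertices P \<inter> e = {u, w}"
proof -
  have e: "e face_of P" "aff_dim e = 1" using assms(2) by (auto simp: edges_def edge_of_def)
  have "polytope e" using assms(1) e(1) face_of_polytope_polytope by blast
  moreover have "e \<noteq> {}" using e(2) by auto
  moreover have "collinear e" using e(2) by (simp add: collinear_aff_dim)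
  ultimately obtain u w where uw: "e = closed_segment u w"
    using compact_convex_collinear_segment polytope_imp_compact polytope_imp_convex by metis
  have ne: "u \<noteq> w" using e(2) uw by auto
  have ext: "vertices P \<inter> e = {u, w}"
    using extreme_point_of_face[OF e(1)] extreme_point_of_segment[of _ u w] uw
    by (auto simp: vertices_def)
  then show ?thesis using that[OF ne uw] by auto
qed

lemma dim_direction_space:
  fixes P :: "'a::euclidean_space set"
  assumes "v \<in> P"
  shows "subspace {d. v + d \<in> affine hull P}" "int (dim {d. v + d \<in> affine hull P}) = aff_dim P"
proof -
  have eq: "{d. v + d \<in> affine hull P} = (+) (-v) ` (affine hull P)"
  proof (intro subset_antisym subsetI)
    fix d assume "d \<in> {d. v + d \<in> affine hull P}"
    then show "d \<in> (+) (-v) ` (affine hull P)"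
      by (intro image_eqI[of _ _ "v + d"]) auto
  qed auto
  show sub: "subspace {d. v + d \<in> affine hull P}"
    unfolding eq using affine_diffs_subspace[OF affine_affine_hull, of v P] assms hull_inc
    by (simp add: hull_inc)
  have "int (dim {d. v + d \<in> affine hull P}) = aff_dim {d. v + d \<in> affine hull P}"
    using aff_dim_subspace[OF sub] by simp
  also have "\<dots> = aff_dim P"
    unfolding eq aff_dim_translation_eq by (simp add: aff_dim_affine_hull)
  finally show "int (dim {d. v + d \<in> affine hull P}) = aff_dim P" .
qed

text \<open>The three facet normals at \<open>v\<close> vanish together on no nonzero direction of the polytope, because
along such a direction one could move away from \<open>v\<close> both ways inside \<open>P\<close>, and
\<open>v\<close> is extreme. As the direction space has dimension three, the normals form a basis of its
dual, and the dual basis (up to sign and scaling) consists of the three edge directions.\<close>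
lemma simple_vertex_frame:
  assumes P: "polytope P" "aff_dim P = 3" and v: "v \<in> vertices P"
    and card3: "card (facets_at P v) = 3"
  obtains n where "vertex_frame P v n"
proof -
  define D where "D = facets_at P v"
  have fin: "finite D" using card3 unfolding D_def by (metis card.infinite zero_neq_numeral)
  have vext: "v extreme_point_of P" using v by (simp add: vertices_def)
  then have vP: "v \<in> P" by (simp add: extreme_point_of_def)
  from halfspace_of_facet[OF P(1)] obtain a b where
    sub: "\<And>f. f \<in> facets P \<Longrightarrow> P \<subseteq> {x. a f \<bullet> x \<le> b f}"
    and eq: "\<And>f. f \<in> facets P \<Longrightarrow> f = P \<inter> {x. a f \<bullet> x = b f}"
    by metis
  have mem: "x \<in> f \<longleftrightarrow> x \<in> P \<and> a f \<bullet> x = b f" if "f \<in> facets P" for x f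
    using eq[OF that] by blast
  define L where "L = {d. v + d \<in> affine hull P}"
  have L: "subspace L" "dim L = 3"
    using dim_direction_space[OF vP] P(2) unfolding L_def by auto
  have DP: "f \<in> facets P" "a f \<bullet> v = b f" if "f \<in> D" for f
    using that by (auto simp: D_def facets_at_def mem)
  have kernel: "d = 0" if d: "d \<in> L" "\<And>f. f \<in> D \<Longrightarrow> a f \<bullet> d = 0" for d
  proof (rule ccontr)
    assume "d \<noteq> 0"
    have nd: "- d \<in> L" using L(1) d(1) by (rule subspace_neg)
    obtain \<epsilon> where e1: "\<epsilon> > 0" "v + \<epsilon> *\<^sub>R d \<in> P"
      using polytope_move_along_tangent[OF P(1) sub eq vP, of d] d unfolding L_def D_def by auto
    obtain \<delta> where e2: "\<delta> > 0" "v + \<delta> *\<^sub>R (-d) \<in> P"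
      using polytope_move_along_tangent[OF P(1) sub eq vP, of "-d"] d nd unfolding L_def D_def by auto
    have "v \<in> open_segment (v + \<epsilon> *\<^sub>R d) (v + \<delta> *\<^sub>R (-d))"
      unfolding in_segment
    proof (intro conjI exI[of _ "\<epsilon> / (\<epsilon> + \<delta>)"])
      show "v + \<epsilon> *\<^sub>R d \<noteq> v + \<delta> *\<^sub>R - d"
      proof
        assume "v + \<epsilon> *\<^sub>R d = v + \<delta> *\<^sub>R - d"
        then have "(\<epsilon> + \<delta>) *\<^sub>R d = 0" by (simp add: scaleR_left_distrib)
        then show False using e1 e2 \<open>d \<noteq> 0\<close> by auto
      qed
      define q where "q = \<epsilon> / (\<epsilon> + \<delta>)"
      have "(1 - q) * \<epsilon> - q * \<delta> = 0"
        using e1 e2 by (simp add: q_def field_simps)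
      moreover have "(1 - q) *\<^sub>R (v + \<epsilon> *\<^sub>R d) + q *\<^sub>R (v + \<delta> *\<^sub>R - d) = v + ((1 - q) * \<epsilon> - q * \<delta>) *\<^sub>R d"
        by (simp add: algebra_simps)
      ultimately show "v = (1 - \<epsilon> / (\<epsilon> + \<delta>)) *\<^sub>R (v + \<epsilon> *\<^sub>R d) + (\<epsilon> / (\<epsilon> + \<delta>)) *\<^sub>R (v + \<delta> *\<^sub>R - d)"
        unfolding q_def by simp
    qed (use e1 e2 in auto)
    then show False using vext e1 e2 unfolding extreme_point_of_def by blast
  qed
  have "\<exists>d. d \<in> L \<and> v + d \<in> P \<and> a f \<bullet> d < 0 \<and> (\<forall>g\<in>D-{f}. a g \<bullet> d = 0)" if f: "f \<in> D" for f
  proof -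
    \<comment> \<open>Two linear conditions leave a nonzero direction; its sign is chosen to point into the polytope.\<close>
    have "card (D - {f}) < dim L" using f fin card3 L by (simp add: D_def)
    then obtain d where d: "d \<in> L" "d \<noteq> 0" "\<forall>g\<in>D-{f}. a g \<bullet> d = 0"
      using exists_orthogonal_in_subspace[of "D - {f}" L] fin L by blast
    have "a f \<bullet> d \<noteq> 0" using kernel[OF d(1)] d by blast
    define d' where "d' = (if a f \<bullet> d < 0 then d else - d)"
    have d': "d' \<in> L" "a f \<bullet> d' < 0" "\<forall>g\<in>D-{f}. a g \<bullet> d' = 0"
      using d \<open>a f \<bullet> d \<noteq> 0\<close> subspace_neg[OF L(1) d(1)] by (auto simp: d'_def)
    have "a g \<bullet> d' \<le> 0" if "g \<in> D" for g using d' that by (cases "g = f") auto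
    then obtain \<epsilon> where e: "\<epsilon> > 0" "v + \<epsilon> *\<^sub>R d' \<in> P"
      using polytope_move_along_tangent[OF P(1) sub eq vP, of d'] d' unfolding L_def D_def by auto
    show ?thesis
      using e d' subspace_scale[OF L(1) d'(1), of \<epsilon>]
      by (intro exI[of _ "\<epsilon> *\<^sub>R d'"]) (auto simp: mult_pos_neg)
  qed
  then obtain d where d: "\<And>f. f \<in> D \<Longrightarrow> d f \<in> L" "\<And>f. f \<in> D \<Longrightarrow> v + d f \<in> P"
    "\<And>f. f \<in> D \<Longrightarrow> a f \<bullet> d f < 0" "\<And>f g. \<lbrakk>f \<in> D; g \<in> D; g \<noteq> f\<rbrakk> \<Longrightarrow> a g \<bullet> d f = 0"
    by (metis Diff_iff singletonD)
  have expand: "\<exists>t. (\<forall>f\<in>D. t f \<ge> 0 \<and> (x \<in> f \<longleftrightarrow> t f = 0)) \<and> x = v + (\<Sum>f\<in>D. t f *\<^sub>R d f)"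
    if x: "x \<in> P" for x
  proof -
    \<comment> \<open>Coordinates with respect to the dual basis; numerator and denominator are both nonpositive.\<close>
    define t where "t f = (a f \<bullet> (x - v)) / (a f \<bullet> d f)" for f
    have le: "a f \<bullet> (x - v) \<le> 0" if "f \<in> D" for f
      using sub[OF DP(1)[OF that]] x DP(2)[OF that] by (auto simp: inner_diff_right)
    have "x - v - (\<Sum>f\<in>D. t f *\<^sub>R d f) = 0"
    proof (rule kernel)
      have "x - v \<in> L" using x by (simp add: L_def hull_inc)
      then show "x - v - (\<Sum>f\<in>D. t f *\<^sub>R d f) \<in> L"
        using subspace_diff[OF L(1), of "x - v" "\<Sum>f\<in>D. t f *\<^sub>R d f"]
          subspace_sum[OF L(1), of D "\<lambda>f. t f *\<^sub>R d f"] subspace_scale[OF L(1)] d(1) by blast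
      fix g assume g: "g \<in> D"
      have "a g \<bullet> (\<Sum>f\<in>D. t f *\<^sub>R d f) = (\<Sum>f\<in>D. t f * (a g \<bullet> d f))"
        by (simp add: inner_sum_right)
      also have "\<dots> = (\<Sum>f\<in>D. if f = g then t g * (a g \<bullet> d g) else 0)"
        by (intro sum.cong refl) (use d(4) g in auto)
      also have "\<dots> = t g * (a g \<bullet> d g)" using g fin by simp
      also have "\<dots> = a g \<bullet> (x - v)" using d(3)[OF g] by (simp add: t_def)
      finally show "a g \<bullet> (x - v - (\<Sum>f\<in>D. t f *\<^sub>R d f)) = 0" by (simp add: inner_diff_right)
    qed
    then have 1: "x = v + (\<Sum>f\<in>D. t f *\<^sub>R d f)" by (simp add: algebra_simps)
    have 2: "t f \<ge> 0 \<and> (x \<in> f \<longleftrightarrow> t f = 0)" if f: "f \<in> D" for f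
    proof -
      have "x \<in> f \<longleftrightarrow> a f \<bullet> (x - v) = 0"
        using mem[OF DP(1)[OF f]] x DP(2)[OF f] by (auto simp: inner_diff_right)
      then show ?thesis using le[OF f] d(3)[OF f] by (auto simp: t_def divide_nonpos_neg)
    qed
    show ?thesis using 1 2 by blast
  qed
  have opp: "opposite_edge P v f \<in> edges P \<and> v \<in> opposite_edge P v f \<and>
      v + d f \<in> opposite_edge P v f \<and> (\<forall>x\<in>opposite_edge P v f. \<exists>t. x = v + t *\<^sub>R d f)"
    if f: "f \<in> D" for f
  proof -
    let ?E = "opposite_edge P v f"
    have ne: "D - {f} \<noteq> {}" using card3 fin f
      by (metis D_def card.empty card_Diff_singleton diff_Suc_1 numeral_3_eq_3 zero_neq_numeral nat.distinct(1))
    have "\<Inter>(D - {f}) face_of P"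
      by (rule face_of_Inter[OF ne]) (auto dest!: DP(1) simp: facets_def facet_of_imp_face_of)
    moreover from this have "?E = \<Inter>(D - {f})"
      using face_of_imp_subset unfolding opposite_edge_def D_def by blast
    ultimately have E: "?E face_of P" by simp
    have vE: "v \<in> ?E" using vP unfolding opposite_edge_def facets_at_def by auto
    have "v + d f \<in> g" if g: "g \<in> D" "g \<noteq> f" for g
      using mem[OF DP(1)[OF g(1)]] d(2)[OF f] d(4)[OF f g(1)] g DP(2)[OF g(1)]
      by (simp add: inner_add_right)
    then have wE: "v + d f \<in> ?E" using d(2)[OF f] unfolding opposite_edge_def D_def by blast
    have line: "\<exists>t. x = v + t *\<^sub>R d f" if x: "x \<in> ?E" for x
    proof -
      obtain t where t: "\<forall>f\<in>D. t f \<ge> 0 \<and> (x \<in> f \<longleftrightarrow> t f = 0)" "x = v + (\<Sum>f\<in>D. t f *\<^sub>R d f)"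
        using expand x unfolding opposite_edge_def by blast
      have "(\<Sum>f\<in>D. t f *\<^sub>R d f) = (\<Sum>g\<in>D. if g = f then t f *\<^sub>R d f else 0)"
      proof (intro sum.cong refl)
        fix g assume g: "g \<in> D"
        have "t g = 0" if "g \<noteq> f"
        proof -
          have "g \<in> facets_at P v - {f}" using g that by (simp add: D_def)
          then have "x \<in> g" using x unfolding opposite_edge_def by blast
          then show ?thesis using t(1) g by simp
        qed
        then show "t g *\<^sub>R d g = (if g = f then t f *\<^sub>R d f else 0)" by simp
      qed
      also have "\<dots> = t f *\<^sub>R d f" using f fin by simp
      finally have "x = v + t f *\<^sub>R d f" using t(2) by simp
      then show ?thesis ..
    qed
    have "?E \<subseteq> affine hull {v, v + d f}"
    proof
      fix x assume "x \<in> ?E"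
      then obtain t where "x = v + t *\<^sub>R d f" using line by blast
      then have "x = (1 - t) *\<^sub>R v + t *\<^sub>R (v + d f)" by (simp add: algebra_simps)
      then show "x \<in> affine hull {v, v + d f}" unfolding affine_hull_2 mem_Collect_eq
        by (intro exI[of _ "1 - t"] exI[of _ t]) simp
    qed
    then have "aff_dim ?E \<le> aff_dim {v, v + d f}"
      by (metis aff_dim_affine_hull aff_dim_subset)
    moreover have "aff_dim {v, v + d f} \<le> aff_dim ?E"
      by (rule aff_dim_subset) (use vE wE in auto)
    moreover have "aff_dim {v, v + d f} = 1" using d(3)[OF f] by (auto simp: aff_dim_2)
    ultimately have "?E \<in> edges P" using E by (simp add: edges_def edge_of_def)
    then show ?thesis using vE wE line by blast
  qed
  \<comment> \<open>Rescale each direction so that it reaches exactly to the other end of its edge.\<close>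
  have "\<exists>w t. w \<in> vertices P \<and> w \<noteq> v \<and> opposite_edge P v f = closed_segment v w \<and>
     t > 0 \<and> w = v + t *\<^sub>R d f" if f: "f \<in> D" for f
  proof -
    let ?E = "opposite_edge P v f"
    obtain u w where uw: "u \<noteq> w" "?E = closed_segment u w" "u \<in> vertices P" "w \<in> vertices P"
      "vertices P \<inter> ?E = {u, w}"
      using edge_is_segment[OF P(1)] opp[OF f] by metis
    then have "v = u \<or> v = w" using v opp[OF f] by blast
    then obtain w' where w': "w' \<in> vertices P" "w' \<noteq> v" "?E = closed_segment v w'"
      using uw by (metis closed_segment_commute)
    then have "w' \<in> ?E" by simp
    then obtain t where t: "w' = v + t *\<^sub>R d f" using opp[OF f] by blast
    have "a f \<bullet> w' \<le> b f" using \<open>w' \<in> ?E\<close> sub[OF DP(1)[OF f]] by (auto simp: opposite_edge_def)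
    then have "t * (a f \<bullet> d f) \<le> 0" using t DP(2)[OF f] by (simp add: inner_add_right)
    then have "t \<ge> 0" using d(3)[OF f] by (simp add: mult_le_0_iff)
    moreover have "t \<noteq> 0" using t w' by auto
    ultimately show ?thesis using w' t by (intro exI[of _ w'] exI[of _ t]) auto
  qed
  then obtain n s where n: "\<And>f. f \<in> D \<Longrightarrow> n f \<in> vertices P \<and> n f \<noteq> v
     \<and> opposite_edge P v f = closed_segment v (n f)"
    and s: "\<And>f. f \<in> D \<Longrightarrow> s f > (0::real) \<and> n f = v + s f *\<^sub>R d f"
    by metis
  have "n f \<notin> f" if f: "f \<in> D" for f
  proof
    assume "n f \<in> f"
    then have "a f \<bullet> n f = b f" using eq[OF DP(1)[OF f]] by blast
    moreover have "a f \<bullet> n f = b f + s f * (a f \<bullet> d f)"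
      using s[OF f] DP(2)[OF f] by (simp add: inner_add_right)
    ultimately show False using s[OF f] d(3)[OF f] by simp
  qed
  moreover have "\<exists>t. (\<forall>f\<in>D. t f \<ge> 0 \<and> (x \<in> f \<longleftrightarrow> t f = 0)) \<and> x = v + (\<Sum>f\<in>D. t f *\<^sub>R (n f - v))"
    if x: "x \<in> P" for x
  proof -
    obtain t where t: "\<forall>f\<in>D. t f \<ge> 0 \<and> (x \<in> f \<longleftrightarrow> t f = 0)" "x = v + (\<Sum>f\<in>D. t f *\<^sub>R d f)"
      using expand[OF x] by blast
    have "t f *\<^sub>R d f = (t f / s f) *\<^sub>R (n f - v)" if f: "f \<in> D" for f
    proof -
      have "n f - v = s f *\<^sub>R d f" "s f \<noteq> 0" using s[OF f] by auto
      then show ?thesis by simp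
    qed
    then have "(\<Sum>f\<in>D. t f *\<^sub>R d f) = (\<Sum>f\<in>D. (t f / s f) *\<^sub>R (n f - v))"
      by (intro sum.cong refl)
    moreover have "t f / s f \<ge> 0 \<and> (x \<in> f \<longleftrightarrow> t f / s f = 0)" if f: "f \<in> D" for f
      using t(1) s[OF f] f by simp
    ultimately show ?thesis using t(2) by (intro exI[of _ "\<lambda>f. t f / s f"]) simp
  qed
  ultimately have "vertex_frame P v n"
    unfolding vertex_frame_def D_def[symmetric] using n opp by simp
  then show ?thesis by (rule that)
qed

section \<open>Graph and facets of a simple 3-polytope\<close>

lemma finite_vertices: "polytope P \<Longrightarrow> finite (vertices P)"
  unfolding vertices_def by (rule finite_polyhedron_extreme_points[OF polytope_imp_polyhedron])

lemma finite_facets: "polytope P \<Longrightarrow> finite (facets P)"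
  unfolding facets_def by (rule finite_polytope_facets)

lemma finite_edges: "polytope P \<Longrightarrow> finite (edges P)"
  using finite_polytope_faces[of P] unfolding edges_def edge_of_def
  by (rule rev_finite_subset) auto

lemma face_eq_hull_vertices:
  assumes "polytope P" "F face_of P"
  shows "F = convex hull (vertices P \<inter> F)"
proof -
  have "polytope F" using assms face_of_polytope_polytope by blast
  then have "F = convex hull {x. x extreme_point_of F}"
    by (intro Krein_Milman_Minkowski polytope_imp_compact polytope_imp_convex)
  also have "{x. x extreme_point_of F} = vertices P \<inter> F"
    using extreme_point_of_face[OF assms(2)] by (auto simp: vertices_def)
  finally show ?thesis .
qed

lemma facet_face: "f \<in> facets P \<Longrightarrow> f face_of P"
  by (simp add: facets_def facet_of_imp_face_of)

lemma facet_has_vertex: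
  assumes "polytope P" "f \<in> facets P"
  shows "\<exists>v\<in>vertices P. v \<in> f"
proof -
  have "f \<noteq> {}" using assms(2) by (simp add: facets_def facet_of_def)
  then have "vertices P \<inter> f \<noteq> {}"
    using face_eq_hull_vertices[OF assms(1) facet_face[OF assms(2)]] by auto
  then show ?thesis by blast
qed

text \<open>The functionals that identify two given points form a hyperplane, and finitely many hyperplanes are a
null set.\<close>
lemma exists_injective_functional:
  fixes V :: "'a::euclidean_space set"
  assumes "finite V"
  shows "\<exists>u. inj_on (\<lambda>v. u \<bullet> v) V"
proof -
  let ?H = "\<lambda>p. {u::'a. (fst p - snd p) \<bullet> u = 0}"
  let ?D = "{p \<in> V \<times> V. fst p \<noteq> snd p}"
  have "negligible (\<Union>p\<in>?D. ?H p)"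
    using assms by (intro negligible_Union) (auto intro!: negligible_hyperplane)
  then have "(\<Union>p\<in>?D. ?H p) \<noteq> UNIV" using non_negligible_UNIV by metis
  then obtain u where u: "u \<notin> (\<Union>p\<in>?D. ?H p)" by blast
  have "inj_on (\<lambda>v. u \<bullet> v) V"
  proof (rule inj_onI, rule ccontr)
    fix v w assume "v \<in> V" "w \<in> V" "u \<bullet> v = u \<bullet> w" "v \<noteq> w"
    then have "u \<in> ?H (v, w)" "(v, w) \<in> ?D"
      by (auto simp: inner_diff_left inner_diff_right inner_commute)
    then show False using u by blast
  qed
  then show ?thesis ..
qed

definition lowest_vertex :: "'a::euclidean_space set \<Rightarrow> 'a \<Rightarrow> 'a set \<Rightarrow> 'a \<Rightarrow> bool" where
  "lowest_vertex P u F v \<longleftrightarrow> v \<in> vertices P \<and> v \<in> F \<and> (\<forall>x\<in>F. u \<bullet> v \<le> u \<bullet> x)"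

lemma face_has_unique_lowest_vertex:
  assumes P: "polytope P" and F: "F face_of P" "F \<noteq> {}"
    and inj: "inj_on (\<lambda>v. u \<bullet> v) (vertices P)"
  shows "card {v\<in>vertices P. lowest_vertex P u F v} = 1"
proof -
  let ?V = "vertices P \<inter> F"
  have hull: "F = convex hull ?V" by (rule face_eq_hull_vertices[OF P F(1)])
  then have ne: "?V \<noteq> {}" using F(2) by auto
  have fin: "finite ?V" using finite_vertices[OF P] by simp
  obtain v where v: "v \<in> ?V" "\<And>w. w \<in> ?V \<Longrightarrow> u \<bullet> v \<le> u \<bullet> w"
    using arg_min_if_finite(1)[OF fin ne, of "\<lambda>v. u \<bullet> v"]
      arg_min_least[OF fin ne, of _ "\<lambda>v. u \<bullet> v"] by blast
  have "convex hull ?V \<subseteq> {x. u \<bullet> x \<ge> u \<bullet> v}"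
    by (rule hull_minimal) (use v(2) convex_halfspace_ge in auto)
  then have low: "lowest_vertex P u F v"
    using v hull unfolding lowest_vertex_def by blast
  moreover have "w = v" if w: "lowest_vertex P u F w" for w
  proof -
    have "u \<bullet> w = u \<bullet> v" using w low unfolding lowest_vertex_def by (auto intro: antisym)
    then show ?thesis using inj w low unfolding lowest_vertex_def inj_on_def by blast
  qed
  ultimately have "{v\<in>vertices P. lowest_vertex P u F v} = {v}"
    unfolding lowest_vertex_def by blast
  then show ?thesis by simp
qed

text \<open>If the three signs agree, every pair of them agrees, which gives three pairs; otherwise exactly one
pair agrees. The element \<open>h\<close> of \<open>D\<close> stands for the pair \<open>D - {h}\<close>.\<close>
lemma sign_count_three:
  fixes s :: "'b \<Rightarrow> real"
  assumes "card D = 3" "\<And>f. f \<in> D \<Longrightarrow> s f \<noteq> 0"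
  shows "card {h\<in>D. \<forall>f\<in>D-{h}. 0 \<le> s f} + card {h\<in>D. \<forall>f\<in>D-{h}. s f \<le> 0}
     = 1 + (if \<forall>f\<in>D. 0 \<le> s f then 2 else 0) + (if \<forall>f\<in>D. s f \<le> 0 then 2 else 0)"
proof -
  obtain p q r where D: "D = {p, q, r}" "p \<noteq> q" "q \<noteq> r" "p \<noteq> r"
    using assms(1) by (auto simp: card_3_iff)
  have split: "{h\<in>D. Q h} = (if Q p then {p} else {}) \<union> (if Q q then {q} else {}) \<union> (if Q r then {r} else {})" for Q
    using D by auto
  have "D - {p} = {q, r}" "D - {q} = {p, r}" "D - {r} = {p, q}" using D by auto
  moreover have "s p \<noteq> 0" "s q \<noteq> 0" "s r \<noteq> 0" using assms(2) D by auto
  ultimately show ?thesis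
    unfolding split using D
    by (cases "s p > 0"; cases "s q > 0"; cases "s r > 0") (simp_all add: not_less)
qed

locale simple_3polytope =
  fixes P :: "'a::euclidean_space set"
  assumes polytope: "polytope P" and dim3: "aff_dim P = 3" and simple: "simple3 P"
begin

abbreviation "V \<equiv> vertices P"
abbreviation "facs \<equiv> facets_at P"

definition neighbour :: "'a \<Rightarrow> 'a set \<Rightarrow> 'a" where
  "neighbour v = (SOME n. vertex_frame P v n)"

lemma card_facets_at: "v \<in> V \<Longrightarrow> card (facs v) = 3"
  using simple by (simp add: simple3_def facets_at_def)

lemma finite_facets_at: "finite (facs v)"
  using finite_facets[OF polytope] by (simp add: facets_at_def)

lemma neighbour_frame: "v \<in> V \<Longrightarrow> vertex_frame P v (neighbour v)"
  unfolding neighbour_def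
  using simple_vertex_frame[OF polytope dim3 _ card_facets_at] by (metis someI)

lemma
  assumes "v \<in> V" "f \<in> facs v"
  shows neighbour_vertex: "neighbour v f \<in> V"
    and neighbour_neq: "neighbour v f \<noteq> v"
    and neighbour_notin: "neighbour v f \<notin> f"
    and opposite_edge_edge: "opposite_edge P v f \<in> edges P"
    and opposite_edge_segment: "opposite_edge P v f = closed_segment v (neighbour v f)"
  using neighbour_frame[OF assms(1)] assms(2) unfolding vertex_frame_def by blast+

lemma cone_coordinates:
  assumes "v \<in> V" "x \<in> P"
  obtains t where "\<And>f. f \<in> facs v \<Longrightarrow> t f \<ge> 0" "\<And>f. f \<in> facs v \<Longrightarrow> x \<in> f \<longleftrightarrow> t f = 0"
    "x = v + (\<Sum>f\<in>facs v. t f *\<^sub>R (neighbour v f - v))"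
  using neighbour_frame[OF assms(1)] assms(2) unfolding vertex_frame_def by meson

lemma opposite_edge_subset: "g \<in> facs v \<Longrightarrow> g \<noteq> f \<Longrightarrow> opposite_edge P v f \<subseteq> g"
  by (auto simp: opposite_edge_def)

lemma neighbour_in_facet:
  assumes "v \<in> V" "f \<in> facs v" "g \<in> facs v" "g \<noteq> f"
  shows "neighbour v f \<in> g"
  using opposite_edge_subset[OF assms(3,4)] opposite_edge_segment[OF assms(1,2)] by auto

lemma facets_at_neighbour:
  assumes "v \<in> V" "f \<in> facs v"
  shows "facs v - {f} \<subseteq> facs (neighbour v f)"
  using neighbour_in_facet[OF assms] by (auto simp: facets_at_def)

lemma facets_at_adjacent:
  assumes "v \<in> V" "f \<in> facs v" "g \<in> facs v" "f \<noteq> g"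
  shows "adjacent_facets P f g"
proof -
  have "card (facs v - {f, g}) = 1"
    using card_facets_at[OF assms(1)] assms finite_facets_at by (simp add: card_Diff_subset)
  then obtain h where "h \<in> facs v - {f, g}" by (auto simp: card_1_singleton_iff)
  then have h: "h \<in> facs v" "f \<noteq> h" "g \<noteq> h" by auto
  have "opposite_edge P v h \<in> edges P" "opposite_edge P v h \<subseteq> f" "opposite_edge P v h \<subseteq> g"
    using opposite_edge_edge[OF assms(1) h(1)] opposite_edge_subset[OF assms(2) h(2)]
      opposite_edge_subset[OF assms(3) h(3)] by blast+
  moreover have "f \<in> facets P" "g \<in> facets P" using assms by (simp_all add: facets_at_def)
  ultimately show ?thesis using assms(4) unfolding adjacent_facets_def by blast
qed

text \<open>An edge is the intersection of the facets containing it. These are among the three facets through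
\<open>v\<close>, and not all of them, since the three meet only in \<open>v\<close>. Hence the edge contains an
opposite edge, and both have dimension one.\<close>
lemma edge_at_is_opposite_edge:
  assumes v: "v \<in> V" and e: "e \<in> edges P" "v \<in> e"
  shows "\<exists>f\<in>facs v. e = opposite_edge P v f"
proof -
  have ef: "e face_of P" "aff_dim e = 1" using e by (auto simp: edges_def edge_of_def)
  have "e \<noteq> {}" "e \<noteq> P" using e dim3 ef by auto
  then have eq: "e = \<Inter>{F. F facet_of P \<and> e \<subseteq> F}"
    using face_of_polyhedron[OF polytope_imp_polyhedron[OF polytope] ef(1)] by blast
  have eP: "e \<subseteq> P" using ef(1) by (rule face_of_imp_subset)
  obtain u w where uw: "u \<noteq> w" "e = closed_segment u w" "V \<inter> e = {u, w}"
    using edge_is_segment[OF polytope e(1)] by metis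
  then obtain w' where w': "w' \<in> e" "w' \<noteq> v" by blast
  have "\<exists>f\<in>facs v. \<not> e \<subseteq> f"
  proof (rule ccontr)
    assume "\<not> (\<exists>f\<in>facs v. \<not> e \<subseteq> f)"
    then have all: "w' \<in> f" if "f \<in> facs v" for f using that w' by blast
    obtain t where t: "\<And>f. f \<in> facs v \<Longrightarrow> w' \<in> f \<longleftrightarrow> t f = 0"
      "w' = v + (\<Sum>f\<in>facs v. t f *\<^sub>R (neighbour v f - v))"
      using cone_coordinates[OF v, of w'] w' eP by blast
    have "(\<Sum>f\<in>facs v. t f *\<^sub>R (neighbour v f - v)) = 0"
      using all t(1) by (intro sum.neutral) auto
    then show False using t(2) w'(2) by simp
  qed
  then obtain f where f: "f \<in> facs v" "\<not> e \<subseteq> f" by blast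
  have "{F. F facet_of P \<and> e \<subseteq> F} \<subseteq> facs v - {f}"
    using f e(2) by (auto simp: facets_at_def facets_def)
  then have "\<Inter>(facs v - {f}) \<subseteq> e" by (subst eq) (rule Inter_anti_mono)
  then have sub: "opposite_edge P v f \<subseteq> e" by (auto simp: opposite_edge_def)
  have opp: "opposite_edge P v f face_of P" "aff_dim (opposite_edge P v f) = 1"
    using opposite_edge_edge[OF v f(1)] by (auto simp: edges_def edge_of_def)
  have "opposite_edge P v f face_of e" using face_of_subset[OF opp(1) sub eP] .
  then have "opposite_edge P v f = e"
    using face_of_aff_dim_lt[of e "opposite_edge P v f"] face_of_imp_convex[OF ef(1)]
      polytope_imp_convex[OF polytope] opp ef by fastforce
  then show ?thesis using f by blast
qed

lemma card_edges_at:
  assumes v: "v \<in> V"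
  shows "card {e\<in>edges P. v \<in> e} = 3"
proof -
  have mem: "v \<in> opposite_edge P v f" if "f \<in> facs v" for f
    using opposite_edge_segment[OF v that] by simp
  then have "{e\<in>edges P. v \<in> e} = opposite_edge P v ` facs v"
    using edge_at_is_opposite_edge[OF v] opposite_edge_edge[OF v] by blast
  moreover have "inj_on (opposite_edge P v) (facs v)"
  proof (rule inj_onI, rule ccontr)
    fix f g assume fg: "f \<in> facs v" "g \<in> facs v" "opposite_edge P v f = opposite_edge P v g" "f \<noteq> g"
    then have "neighbour v f \<in> opposite_edge P v g"
      using opposite_edge_segment[OF v fg(1)] by auto
    then have "neighbour v f \<in> f" using opposite_edge_subset[OF fg(1,4)] by blast
    then show False using neighbour_notin[OF v fg(1)] by simp
  qed
  ultimately show ?thesis using card_image card_facets_at[OF v] by metis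
qed

lemma card_edge_vertices: "e \<in> edges P \<Longrightarrow> card {v\<in>V. v \<in> e} = 2"
proof -
  assume "e \<in> edges P"
  then obtain u w where "u \<noteq> w" "V \<inter> e = {u, w}"
    using edge_is_segment[OF polytope] by metis
  moreover have "{v\<in>V. v \<in> e} = V \<inter> e" by blast
  ultimately show ?thesis by simp
qed

lemma handshake: "2 * card (edges P) = 3 * card V"
proof -
  have "(\<Sum>v\<in>V. card {e\<in>edges P. v \<in> e}) = 2 * card (edges P)"
    by (rule sum_multicount[OF finite_vertices[OF polytope] finite_edges[OF polytope]])
       (use card_edge_vertices in blast)
  then show ?thesis using card_edges_at by simp
qed

text \<open>The simplex-method principle: in the cone coordinates at \<open>v\<close>, a linear functional is minimal
at \<open>v\<close> on the intersection of the facets in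
\<open>H\<close> as soon as it does not decrease along the edges at \<open>v\<close> in this intersection. Taking \<open>H\<close> empty or a single
facet gives the statement for the whole polytope and for a facet.\<close>
lemma lowest_iff_neighbours:
  assumes v: "v \<in> V" and H: "H \<subseteq> facs v"
  shows "(\<forall>x\<in>P \<inter> \<Inter>H. u \<bullet> v \<le> u \<bullet> x) \<longleftrightarrow> (\<forall>f\<in>facs v - H. u \<bullet> v \<le> u \<bullet> neighbour v f)"
proof safe
  fix f assume "\<forall>x\<in>P \<inter> \<Inter>H. u \<bullet> v \<le> u \<bullet> x" "f \<in> facs v" "f \<notin> H"
  moreover have "neighbour v f \<in> P \<inter> \<Inter>H"
  proof
    show "neighbour v f \<in> P"
      using neighbour_vertex[OF v \<open>f \<in> facs v\<close>] by (simp add: vertices_def extreme_point_of_def)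
    show "neighbour v f \<in> \<Inter>H"
      using neighbour_in_facet[OF v \<open>f \<in> facs v\<close>] H \<open>f \<notin> H\<close> by blast
  qed
  ultimately show "u \<bullet> v \<le> u \<bullet> neighbour v f" by blast
next
  fix x assume up: "\<forall>f\<in>facs v - H. u \<bullet> v \<le> u \<bullet> neighbour v f" and x: "x \<in> P" "x \<in> \<Inter>H"
  obtain t where t: "\<And>f. f \<in> facs v \<Longrightarrow> t f \<ge> 0" "\<And>f. f \<in> facs v \<Longrightarrow> x \<in> f \<longleftrightarrow> t f = 0"
    "x = v + (\<Sum>f\<in>facs v. t f *\<^sub>R (neighbour v f - v))"
    using cone_coordinates[OF v x(1)] by blast
  have "0 \<le> t f * (u \<bullet> neighbour v f - u \<bullet> v)" if f: "f \<in> facs v" for f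
  proof (cases "f \<in> H")
    case True
    then have "t f = 0" using t(2)[OF f] x(2) by blast
    then show ?thesis by simp
  next
    case False
    then show ?thesis using up t(1)[OF f] f by (intro mult_nonneg_nonneg) auto
  qed
  then have "0 \<le> (\<Sum>f\<in>facs v. t f * (u \<bullet> neighbour v f - u \<bullet> v))" by (rule sum_nonneg)
  also have "\<dots> = u \<bullet> (\<Sum>f\<in>facs v. t f *\<^sub>R (neighbour v f - v))"
    by (simp add: inner_sum_right inner_diff_right)
  finally show "u \<bullet> v \<le> u \<bullet> x" by (subst t(3)) (simp add: inner_add_right)
qed

lemma vertex_in: "v \<in> V \<Longrightarrow> v \<in> P"
  by (simp add: vertices_def extreme_point_of_def)

lemma lowest_in_polytope_iff:
  assumes "v \<in> V"
  shows "lowest_vertex P u P v \<longleftrightarrow> (\<forall>f\<in>facs v. u \<bullet> v \<le> u \<bullet> neighbour v f)"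
  using lowest_iff_neighbours[OF assms, of "{}" u] assms vertex_in by (simp add: lowest_vertex_def)

lemma lowest_in_facet_iff:
  assumes "v \<in> V"
  shows "h \<in> facets P \<and> lowest_vertex P u h v \<longleftrightarrow>
    h \<in> facs v \<and> (\<forall>f\<in>facs v - {h}. u \<bullet> v \<le> u \<bullet> neighbour v f)"
proof (cases "h \<in> facs v")
  case True
  then have "h \<in> facets P" "v \<in> h" by (auto simp: facets_at_def)
  moreover from this have "P \<inter> \<Inter>{h} = h"
    using face_of_imp_subset[OF facet_face] by fastforce
  ultimately show ?thesis
    using lowest_iff_neighbours[OF assms, of "{h}" u] True assms by (simp add: lowest_vertex_def)
next
  case False
  then show ?thesis by (auto simp: facets_at_def lowest_vertex_def)
qed

lemma card_facets_eq_lowest_count: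
  assumes inj: "inj_on (\<lambda>v. u \<bullet> v) V"
  shows "card (facets P) =
    (\<Sum>v\<in>V. card {h\<in>facs v. \<forall>f\<in>facs v - {h}. u \<bullet> v \<le> u \<bullet> neighbour v f})"
proof -
  have "(\<Sum>v\<in>V. card {h\<in>facets P. lowest_vertex P u h v}) = 1 * card (facets P)"
  proof (rule sum_multicount[OF finite_vertices[OF polytope] finite_facets[OF polytope]], rule ballI)
    fix h assume h: "h \<in> facets P"
    then have "h \<noteq> {}" by (simp add: facets_def facet_of_def)
    then show "card {v\<in>V. lowest_vertex P u h v} = 1"
      using face_has_unique_lowest_vertex[OF polytope facet_face[OF h] _ inj] by blast
  qed
  then show ?thesis using lowest_in_facet_iff by simp
qed

lemma sum_lowest_in_polytope:
  assumes inj: "inj_on (\<lambda>v. u \<bullet> v) V"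
  shows "(\<Sum>v\<in>V. if \<forall>f\<in>facs v. u \<bullet> v \<le> u \<bullet> neighbour v f then 2 else 0) = (2::nat)"
proof -
  have "P \<noteq> {}" using dim3 by auto
  then have "card {v\<in>V. lowest_vertex P u P v} = 1"
    using face_has_unique_lowest_vertex[OF polytope face_of_refl[OF polytope_imp_convex[OF polytope]] _ inj] by blast
  moreover have "(\<Sum>v\<in>V. if lowest_vertex P u P v then 2 else 0) = (\<Sum>v\<in>{v\<in>V. lowest_vertex P u P v}. (2::nat))"
    using finite_vertices[OF polytope] by (rule sum.inter_filter[symmetric])
  ultimately have "(\<Sum>v\<in>V. if lowest_vertex P u P v then 2 else 0) = (2::nat)" by simp
  then show ?thesis using lowest_in_polytope_iff by simp
qed

text \<open>This form of Euler's relation for simple polytopes is obtained by counting the pairs of a facet and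
its lowest or highest vertex with respect to a generic functional, which are \<open>2 * card (facets P)\<close>
many. A vertex \<open>v\<close> is extremal on the facet \<open>h\<close> through it iff the two edges of
\<open>h\<close> at \<open>v\<close> go both up or both down. Among the three edges at \<open>v\<close> there is
exactly one such pair, except at the lowest and at the highest vertex of \<open>P\<close>, where all three
pairs qualify.\<close>
theorem vertices_facets_formula: "2 * card (facets P) = card V + 4"
proof -
  obtain u where inj: "inj_on (\<lambda>v. u \<bullet> v) V"
    using exists_injective_functional[OF finite_vertices[OF polytope]] ..
  then have inj': "inj_on (\<lambda>v. (-u) \<bullet> v) V" by (simp add: inj_on_def)
  let ?up = "\<lambda>v f. u \<bullet> v \<le> u \<bullet> neighbour v f"
  let ?down = "\<lambda>v f. (-u) \<bullet> v \<le> (-u) \<bullet> neighbour v f"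
  have "2 * card (facets P) = (\<Sum>v\<in>V. card {h\<in>facs v. \<forall>f\<in>facs v - {h}. ?up v f}
      + card {h\<in>facs v. \<forall>f\<in>facs v - {h}. ?down v f})"
    using card_facets_eq_lowest_count[OF inj] card_facets_eq_lowest_count[OF inj']
    by (simp only: sum.distrib mult_2)
  also have "\<dots> = (\<Sum>v\<in>V. 1 + (if \<forall>f\<in>facs v. ?up v f then 2 else 0)
      + (if \<forall>f\<in>facs v. ?down v f then 2 else 0))"
  proof (rule sum.cong[OF refl])
    fix v assume v: "v \<in> V"
    have "u \<bullet> neighbour v f - u \<bullet> v \<noteq> 0" if "f \<in> facs v" for f
      using inj v neighbour_vertex[OF v that] neighbour_neq[OF v that] by (auto simp: inj_on_def)
    from sign_count_three[OF card_facets_at[OF v], of "\<lambda>f. u \<bullet> neighbour v f - u \<bullet> v", OF this]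
    show "card {h\<in>facs v. \<forall>f\<in>facs v - {h}. ?up v f} + card {h\<in>facs v. \<forall>f\<in>facs v - {h}. ?down v f}
      = 1 + (if \<forall>f\<in>facs v. ?up v f then 2 else 0) + (if \<forall>f\<in>facs v. ?down v f then 2 else 0)"
      by simp
  qed
  also have "\<dots> = card V + 4"
    using sum_lowest_in_polytope[OF inj] sum_lowest_in_polytope[OF inj']
    by (simp only: sum.distrib) simp
  finally show ?thesis .
qed

end

section \<open>Linear relations between incidence vectors\<close>

locale coloured_simple_3polytope = simple_3polytope +
  fixes c :: "'a set \<Rightarrow> nat"
  assumes proper: "proper_3_coloring P c"
begin

definition colour_class :: "nat \<Rightarrow> 'a set set" where
  "colour_class i = {f\<in>facets P. c f = i}"

lemma colour_range: "f \<in> facets P \<Longrightarrow> c f \<in> {1, 2, 3}"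
  using proper by (simp add: proper_3_coloring_def)

text \<open>Any two of the three facets at a vertex share an edge, so all three colours occur there. Consequently
the incidence vectors of each colour class sum up to the all-ones vector.\<close>
lemma colours_at_vertex:
  assumes v: "v \<in> V"
  shows "bij_betw c (facs v) {1, 2, 3}"
proof -
  have inj: "inj_on c (facs v)"
  proof (rule inj_onI, rule ccontr)
    fix f g assume "f \<in> facs v" "g \<in> facs v" "c f = c g" "f \<noteq> g"
    then show False
      using facets_at_adjacent[OF v] proper unfolding proper_3_coloring_def by blast
  qed
  have "c ` facs v \<subseteq> {1, 2, 3}" using colour_range by (auto simp: facets_at_def)
  moreover have "card (c ` facs v) = card {1, 2, 3::nat}"
    using card_image[OF inj] card_facets_at[OF v] by simp
  ultimately have "c ` facs v = {1, 2, 3}" by (intro card_subset_eq) auto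
  then show ?thesis using inj by (simp add: bij_betw_def)
qed

lemma sum_colours_at_vertex:
  fixes \<beta> :: "nat \<Rightarrow> real"
  assumes "v \<in> V"
  shows "(\<Sum>f\<in>facs v. \<beta> (c f)) = \<beta> 1 + \<beta> 2 + \<beta> 3"
  using sum.reindex_bij_betw[OF colours_at_vertex[OF assms], of \<beta>] by simp

text \<open>The incidence vectors satisfy no linear relations besides those forced by the colouring. Crossing an
edge exchanges one facet for another one, of the same colour by the colouring and with the same
coefficient by the relation. Every vertex is joined to the lowest one by a descending path of
edges, so the coefficient depends on the colour only.\<close>
lemma vertex_relation_constant_on_colours:
  fixes a :: "'a set \<Rightarrow> real"
  assumes rel: "\<And>v. v \<in> V \<Longrightarrow> (\<Sum>f\<in>facs v. a f) = 0"
  obtains \<beta> :: "nat \<Rightarrow> real" where "\<beta> 1 + \<beta> 2 + \<beta> 3 = 0" "\<And>f. f \<in> facets P \<Longrightarrow> a f = \<beta> (c f)"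
proof -
  obtain u where inj: "inj_on (\<lambda>v. u \<bullet> v) V"
    using exists_injective_functional[OF finite_vertices[OF polytope]] ..
  have "P \<noteq> {}" using dim3 by auto
  then have "card {v\<in>V. lowest_vertex P u P v} = 1"
    using face_has_unique_lowest_vertex[OF polytope face_of_refl[OF polytope_imp_convex[OF polytope]] _ inj] by blast
  then obtain v0 where low: "{v\<in>V. lowest_vertex P u P v} = {v0}"
    by (auto simp: card_1_singleton_iff)
  then have v0: "v0 \<in> V" by blast
  define \<beta> where "\<beta> = a \<circ> the_inv_into (facs v0) c"
  have b0: "a f = \<beta> (c f)" if "f \<in> facs v0" for f
    using the_inv_into_f_f[of c "facs v0" f] colours_at_vertex[OF v0] that
    by (simp add: \<beta>_def bij_betw_def)
  have s: "\<beta> 1 + \<beta> 2 + \<beta> 3 = 0"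
    using rel[OF v0] sum_colours_at_vertex[OF v0, of \<beta>] b0 by simp
  have "\<forall>f\<in>facs v. a f = \<beta> (c f)" if "v \<in> V" for v
    using that
  proof (induction "card {w\<in>V. u \<bullet> w < u \<bullet> v}" arbitrary: v rule: less_induct)
    case less
    show ?case
    proof (cases "lowest_vertex P u P v")
      case True
      then have "v = v0" using low less.prems by blast
      then show ?thesis using b0 by simp
    next
      case False
      then obtain f where f: "f \<in> facs v" "u \<bullet> neighbour v f < u \<bullet> v"
        using lowest_in_polytope_iff[OF less.prems] by (auto simp: not_le)
      let ?w = "neighbour v f"
      have w: "?w \<in> V" using neighbour_vertex[OF less.prems f(1)] .
      have "{w\<in>V. u \<bullet> w < u \<bullet> ?w} \<subset> {w\<in>V. u \<bullet> w < u \<bullet> v}" using f(2) w by force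
      then have "card {w\<in>V. u \<bullet> w < u \<bullet> ?w} < card {w\<in>V. u \<bullet> w < u \<bullet> v}"
        using finite_vertices[OF polytope] by (intro psubset_card_mono) auto
      then have IH: "a g = \<beta> (c g)" if "g \<in> facs ?w" for g
        using less.hyps w that by blast
      have rest: "a g = \<beta> (c g)" if "g \<in> facs v - {f}" for g
        using IH facets_at_neighbour[OF less.prems f(1)] that by blast
      have "a f + (\<Sum>g\<in>facs v - {f}. a g) = 0"
        using rel[OF less.prems] sum.remove[OF finite_facets_at f(1), of a] by simp
      moreover have "\<beta> (c f) + (\<Sum>g\<in>facs v - {f}. \<beta> (c g)) = 0"
        using sum_colours_at_vertex[OF less.prems, of \<beta>] s
          sum.remove[OF finite_facets_at f(1), of "\<lambda>g. \<beta> (c g)"] by simp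
      moreover have "(\<Sum>g\<in>facs v - {f}. a g) = (\<Sum>g\<in>facs v - {f}. \<beta> (c g))"
        using rest by (intro sum.cong) auto
      ultimately have "a f = \<beta> (c f)" by linarith
      then show ?thesis using rest by blast
    qed
  qed
  then have "a f = \<beta> (c f)" if "f \<in> facets P" for f
    using facet_has_vertex[OF polytope that] that by (auto simp: facets_at_def)
  then show ?thesis using that s by blast
qed

text \<open>Every vertex lies on a facet of each colour; a single facet of some colour would contain all vertices,
hence the whole polytope.\<close>
lemma colour_class_card_ge_2:
  assumes "i \<in> {1, 2, 3}"
  shows "2 \<le> card (colour_class i)"
proof (rule ccontr)
  assume "\<not> 2 \<le> card (colour_class i)"
  then have le1: "card (colour_class i) \<le> 1" by simp
  have fin: "finite (colour_class i)" using finite_facets[OF polytope] by (simp add: colour_class_def)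
  have ex: "\<exists>f\<in>colour_class i. v \<in> f" if "v \<in> V" for v
  proof -
    have "i \<in> c ` facs v" using colours_at_vertex[OF that] assms by (simp add: bij_betw_def)
    then show ?thesis by (auto simp: facets_at_def colour_class_def)
  qed
  have PV: "P = convex hull (V \<inter> P)"
    by (rule face_eq_hull_vertices[OF polytope face_of_refl[OF polytope_imp_convex[OF polytope]]])
  have "P \<noteq> {}" using dim3 by auto
  then obtain v where "v \<in> V" using PV by fastforce
  then obtain h where h: "h \<in> colour_class i" using ex by blast
  have "f = h" if "f \<in> colour_class i" for f
    using le1 that h card_le_Suc0_iff_eq[OF fin] by simp
  then have "V \<inter> P \<subseteq> h" using ex by blast
  moreover have hf: "h facet_of P" using h by (simp add: colour_class_def facets_def)
  ultimately have "P \<subseteq> h"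
    using hull_minimal[of "V \<inter> P" h convex] PV face_of_imp_convex[OF facet_of_imp_face_of[OF hf]]
    by simp
  then have "aff_dim P \<le> aff_dim h" by (rule aff_dim_subset)
  then show False using hf by (simp add: facet_of_def)
qed

end

section \<open>Face lattices as families of index sets\<close>

definition inclusion_isomorphic :: "'a set set \<Rightarrow> 'b set set \<Rightarrow> bool" where
  "inclusion_isomorphic X Y \<longleftrightarrow>
     (\<exists>\<phi>. bij_betw \<phi> X Y \<and> (\<forall>F\<in>X. \<forall>F'\<in>X. F \<subseteq> F' \<longleftrightarrow> \<phi> F \<subseteq> \<phi> F'))"

lemma combinatorially_equivalent_iff:
  "combinatorially_equivalent S T \<longleftrightarrow> inclusion_isomorphic {F. F face_of S} {G. G face_of T}"
  by (auto simp: combinatorially_equivalent_def inclusion_isomorphic_def)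

lemma inclusion_isomorphic_sym:
  assumes "inclusion_isomorphic X Y" shows "inclusion_isomorphic Y X"
proof -
  obtain \<phi> where \<phi>: "bij_betw \<phi> X Y" "\<And>F F'. F \<in> X \<Longrightarrow> F' \<in> X \<Longrightarrow> F \<subseteq> F' \<longleftrightarrow> \<phi> F \<subseteq> \<phi> F'"
    using assms by (auto simp: inclusion_isomorphic_def)
  let ?\<psi> = "inv_into X \<phi>"
  have "bij_betw ?\<psi> Y X" using \<phi>(1) by (rule bij_betw_inv_into)
  moreover have "F \<subseteq> F' \<longleftrightarrow> ?\<psi> F \<subseteq> ?\<psi> F'" if "F \<in> Y" "F' \<in> Y" for F F'
    using \<phi>(2)[of "?\<psi> F" "?\<psi> F'"] bij_betw_inv_into_right[OF \<phi>(1)] that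
      bij_betw_apply[OF \<open>bij_betw ?\<psi> Y X\<close>] by simp
  ultimately show ?thesis unfolding inclusion_isomorphic_def by blast
qed

lemma inclusion_isomorphic_trans:
  assumes "inclusion_isomorphic X Y" "inclusion_isomorphic Y Z" shows "inclusion_isomorphic X Z"
proof -
  obtain \<phi> where \<phi>: "bij_betw \<phi> X Y" "\<And>F F'. F \<in> X \<Longrightarrow> F' \<in> X \<Longrightarrow> F \<subseteq> F' \<longleftrightarrow> \<phi> F \<subseteq> \<phi> F'"
    using assms(1) by (auto simp: inclusion_isomorphic_def)
  obtain \<psi> where \<psi>: "bij_betw \<psi> Y Z" "\<And>F F'. F \<in> Y \<Longrightarrow> F' \<in> Y \<Longrightarrow> F \<subseteq> F' \<longleftrightarrow> \<psi> F \<subseteq> \<psi> F'"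
    using assms(2) by (auto simp: inclusion_isomorphic_def)
  have "bij_betw (\<psi> \<circ> \<phi>) X Z" using bij_betw_trans[OF \<phi>(1) \<psi>(1)] .
  moreover have "F \<subseteq> F' \<longleftrightarrow> (\<psi> \<circ> \<phi>) F \<subseteq> (\<psi> \<circ> \<phi>) F'" if "F \<in> X" "F' \<in> X" for F F'
    using \<phi>(2) \<psi>(2) bij_betw_apply[OF \<phi>(1)] that by simp
  ultimately show ?thesis unfolding inclusion_isomorphic_def by blast
qed

lemma convex_hull_subfamily:
  fixes \<xi> :: "'i \<Rightarrow> 'v::real_vector"
  assumes A: "finite A" and S: "S \<subseteq> A"
  shows "x \<in> convex hull (\<xi> ` S) \<longleftrightarrow>
    (\<exists>u. (\<forall>i\<in>A. 0 \<le> u i) \<and> (\<forall>i\<in>A-S. u i = 0) \<and> sum u A = 1 \<and> x = (\<Sum>i\<in>A. u i *\<^sub>R \<xi> i))"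
    (is "_ \<longleftrightarrow> ?R x")
proof
  have "convex {x. ?R x}"
  proof (rule convexI)
    fix x y and s t :: real
    assume "x \<in> {x. ?R x}" "y \<in> {x. ?R x}" and st: "0 \<le> s" "0 \<le> t" "s + t = 1"
    then obtain u w where
      u: "\<forall>i\<in>A. 0 \<le> u i" "\<forall>i\<in>A-S. u i = 0" "sum u A = 1" "x = (\<Sum>i\<in>A. u i *\<^sub>R \<xi> i)" and
      w: "\<forall>i\<in>A. 0 \<le> w i" "\<forall>i\<in>A-S. w i = 0" "sum w A = 1" "y = (\<Sum>i\<in>A. w i *\<^sub>R \<xi> i)"
      by blast
    have "s *\<^sub>R x + t *\<^sub>R y = (\<Sum>i\<in>A. (s * u i + t * w i) *\<^sub>R \<xi> i)"
      by (simp add: u(4) w(4) scaleR_sum_right sum.distrib scaleR_left_distrib)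
    moreover have "(\<Sum>i\<in>A. s * u i + t * w i) = 1"
      using u(3) w(3) st by (simp add: sum.distrib flip: sum_distrib_left)
    ultimately show "s *\<^sub>R x + t *\<^sub>R y \<in> {x. ?R x}"
      using u w st by (intro CollectI exI[of _ "\<lambda>i. s * u i + t * w i"]) simp
  qed
  moreover have "\<xi> ` S \<subseteq> {x. ?R x}"
  proof clarify
    fix i assume i: "i \<in> S"
    then have "i \<in> A" using S by blast
    have "(\<Sum>j\<in>A. (if j = i then 1 else 0) *\<^sub>R \<xi> j) = (\<Sum>j\<in>A. if j = i then \<xi> j else 0)"
      by (intro sum.cong) auto
    then show "?R (\<xi> i)" using A i \<open>i \<in> A\<close>
      by (intro exI[of _ "\<lambda>j. if j = i then 1 else 0"]) auto
  qed
  ultimately have "convex hull (\<xi> ` S) \<subseteq> {x. ?R x}" by (rule hull_minimal[rotated])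
  then show "x \<in> convex hull (\<xi> ` S) \<Longrightarrow> ?R x" by blast
next
  assume "?R x"
  then obtain u where u: "\<forall>i\<in>A. 0 \<le> u i" "\<forall>i\<in>A-S. u i = 0" "sum u A = 1" "x = (\<Sum>i\<in>A. u i *\<^sub>R \<xi> i)"
    by blast
  have "sum u S = sum u A" "(\<Sum>i\<in>S. u i *\<^sub>R \<xi> i) = (\<Sum>i\<in>A. u i *\<^sub>R \<xi> i)"
    using u(2) by (auto intro!: sum.mono_neutral_left[OF A S])
  moreover have "(\<Sum>i\<in>S. u i *\<^sub>R \<xi> i) \<in> convex hull (\<xi> ` S)"
    using u S calculation finite_subset[OF S A]
    by (intro convex_sum) (auto intro: hull_inc)
  ultimately show "x \<in> convex hull (\<xi> ` S)" using u(4) by simp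
qed

text \<open>The combination either equals \<open>\<xi> j\<close> or lies strictly between \<open>\<xi> j\<close> and a
point of \<open>Q\<close>.\<close>
lemma face_of_contains_supporting_points:
  fixes \<xi> :: "'i \<Rightarrow> 'v::real_vector"
  assumes F: "F face_of Q" and Q: "convex Q" and A: "finite A" "\<xi> ` A \<subseteq> Q"
    and u: "\<And>i. i \<in> A \<Longrightarrow> 0 \<le> u i" "sum u A = 1" "(\<Sum>i\<in>A. u i *\<^sub>R \<xi> i) \<in> F"
    and j: "j \<in> A" "u j > 0"
  shows "\<xi> j \<in> F"
proof -
  let ?p = "\<Sum>i\<in>A. u i *\<^sub>R \<xi> i"
  have s1: "u j + sum u (A - {j}) = 1" using u(2) sum.remove[OF A(1) j(1), of u] by simp
  have p: "?p = u j *\<^sub>R \<xi> j + (\<Sum>i\<in>A-{j}. u i *\<^sub>R \<xi> i)"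
    by (rule sum.remove[OF A(1) j(1)])
  show ?thesis
  proof (cases "u j = 1")
    case True
    then have "sum u (A - {j}) = 0" using s1 by simp
    then have "\<forall>i\<in>A-{j}. u i = 0"
      using sum_nonneg_eq_0_iff[of "A - {j}" u] A(1) u(1) by auto
    then have "(\<Sum>i\<in>A-{j}. u i *\<^sub>R \<xi> i) = 0" by (intro sum.neutral) auto
    then show ?thesis using p True u(3) by simp
  next
    case False
    have "0 \<le> sum u (A - {j})" using u(1) by (intro sum_nonneg) auto
    then have lt: "u j < 1" using False s1 by linarith
    define y where "y = (\<Sum>i\<in>A-{j}. (u i / (1 - u j)) *\<^sub>R \<xi> i)"
    have yQ: "y \<in> Q" unfolding y_def
    proof (rule convex_sum[OF _ Q])
      show "finite (A - {j})" using A(1) by simp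
      show "(\<Sum>i\<in>A-{j}. u i / (1 - u j)) = 1"
        using s1 lt by (simp flip: sum_divide_distrib)
    qed (use u(1) lt A(2) in auto)
    have "(1 - u j) *\<^sub>R y = (\<Sum>i\<in>A-{j}. u i *\<^sub>R \<xi> i)"
      using lt by (simp add: y_def scaleR_sum_right)
    then have p': "?p = (1 - (1 - u j)) *\<^sub>R \<xi> j + (1 - u j) *\<^sub>R y" using p by simp
    show ?thesis
    proof (cases "\<xi> j = y")
      case True
      then have "?p = \<xi> j" using p' by (simp flip: scaleR_left_distrib)
      then show ?thesis using u(3) by simp
    next
      case False
      then have "?p \<in> open_segment (\<xi> j) y"
        unfolding in_segment using p' lt j(2) by (intro conjI exI[of _ "1 - u j"]) auto
      moreover have "\<xi> j \<in> Q" using A(2) j(1) by blast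
      ultimately show ?thesis using face_ofD[OF F _ _ yQ u(3)] by blast
    qed
  qed
qed

text \<open>The Gale-duality criterion for \<open>S\<close> to index the generators on a face: no nontrivial affine
dependency has nonnegative coefficients off \<open>S\<close>, where nontrivial means nonzero somewhere
off \<open>S\<close>.\<close>
definition face_index_set :: "'i set \<Rightarrow> ('i \<Rightarrow> 'v::real_vector) \<Rightarrow> 'i set \<Rightarrow> bool" where
  "face_index_set A \<xi> S \<longleftrightarrow> S \<subseteq> A \<and>
     (\<forall>a. sum a A = 0 \<longrightarrow> (\<Sum>i\<in>A. a i *\<^sub>R \<xi> i) = 0 \<longrightarrow> (\<forall>i\<in>A-S. 0 \<le> a i) \<longrightarrow> (\<forall>i\<in>A-S. a i = 0))"

text \<open>Separating an affine dependency into its positive and negative part gives two convex combinations for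
the same point. If the coefficients off \<open>S\<close> are nonnegative, the negative part is supported on
\<open>S\<close>, so this point is in the face, and then so are all generators that carry positive weight.\<close>
lemma face_imp_face_index_set:
  fixes \<xi> :: "'i \<Rightarrow> 'v::real_vector"
  assumes A: "finite A" and F: "F face_of convex hull (\<xi> ` A)"
  shows "face_index_set A \<xi> {i\<in>A. \<xi> i \<in> F}"
  unfolding face_index_set_def
proof (intro conjI allI impI ballI)
  fix a :: "'i \<Rightarrow> real" and j
  let ?S = "{i\<in>A. \<xi> i \<in> F}"
  assume a: "sum a A = 0" "(\<Sum>i\<in>A. a i *\<^sub>R \<xi> i) = 0" "\<forall>i\<in>A-?S. 0 \<le> a i" and j: "j \<in> A - ?S"
  show "a j = 0"
  proof (rule ccontr)
    assume "a j \<noteq> 0"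
    then have aj: "a j > 0" using a(3) j by force
    define M where "M = (\<Sum>i\<in>A. max (a i) 0)"
    have diff: "max (a i) 0 - max (- a i) 0 = a i" for i by (simp add: max_def)
    have "a j \<le> M" unfolding M_def
      using member_le_sum[of j A "\<lambda>i. max (a i) 0"] A j aj by simp
    then have M: "M > 0" using aj by simp
    have M': "M = (\<Sum>i\<in>A. max (- a i) 0)"
      using a(1) sum_subtractf[of "\<lambda>i. max (a i) 0" "\<lambda>i. max (- a i) 0" A]
      by (simp add: M_def diff)
    have p: "(\<Sum>i\<in>A. max (a i) 0 *\<^sub>R \<xi> i) = (\<Sum>i\<in>A. max (- a i) 0 *\<^sub>R \<xi> i)"
      using a(2) sum_subtractf[of "\<lambda>i. max (a i) 0 *\<^sub>R \<xi> i" "\<lambda>i. max (- a i) 0 *\<^sub>R \<xi> i" A]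
      by (simp add: diff flip: scaleR_left_diff_distrib)
    have scale: "(\<Sum>i\<in>A. (w i / M) *\<^sub>R \<xi> i) = (1 / M) *\<^sub>R (\<Sum>i\<in>A. w i *\<^sub>R \<xi> i)" for w
      by (simp add: scaleR_sum_right)
    have "(\<Sum>i\<in>A. (max (- a i) 0 / M) *\<^sub>R \<xi> i) \<in> convex hull (\<xi> ` ?S)"
      unfolding convex_hull_subfamily[of A ?S, OF A Collect_restrict]
    proof (intro exI[of _ "\<lambda>i. max (- a i) 0 / M"] conjI ballI refl)
      show "(\<Sum>i\<in>A. max (- a i) 0 / M) = 1"
        using M M' by (simp flip: sum_divide_distrib)
      fix i assume "i \<in> A - ?S"
      then have "0 \<le> a i" using a(3) by blast
      then show "max (- a i) 0 / M = 0" by simp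
    qed (use M in auto)
    also have "convex hull (\<xi> ` ?S) \<subseteq> F"
      by (rule hull_minimal) (use face_of_imp_convex[OF F] in auto)
    finally have inF: "(\<Sum>i\<in>A. (max (a i) 0 / M) *\<^sub>R \<xi> i) \<in> F"
      using p by (simp only: scale)
    have "\<xi> j \<in> F"
    proof (rule face_of_contains_supporting_points[OF F convex_convex_hull A _ _ _ inF])
      show "(\<Sum>i\<in>A. max (a i) 0 / M) = 1"
        using M by (simp add: M_def flip: sum_divide_distrib)
    qed (use M j aj in \<open>auto intro: hull_inc\<close>)
    then show False using j by blast
  qed
qed blast

text \<open>A violation of the face property, or a generator off \<open>S\<close> in the hull of those in
\<open>S\<close>, equates two convex combinations of which the second is supported on \<open>S\<close>. Their
difference is an affine dependency that is nonnegative off \<open>S\<close>.\<close>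
lemma face_index_set_imp_face:
  fixes \<xi> :: "'i \<Rightarrow> 'v::real_vector"
  assumes A: "finite A" and S: "face_index_set A \<xi> S"
  shows "convex hull (\<xi> ` S) face_of convex hull (\<xi> ` A)" "{i\<in>A. \<xi> i \<in> convex hull (\<xi> ` S)} = S"
proof -
  have SA: "S \<subseteq> A" using S by (simp add: face_index_set_def)
  have vanish: "a i = 0" if "sum a A = 0" "(\<Sum>i\<in>A. a i *\<^sub>R \<xi> i) = 0" "\<And>i. i \<in> A - S \<Longrightarrow> 0 \<le> a i" "i \<in> A - S" for a i
    using S that unfolding face_index_set_def by blast
  note hull = convex_hull_subfamily[OF A SA, of _ \<xi>]
  show "convex hull (\<xi> ` S) face_of convex hull (\<xi> ` A)"
    unfolding face_of_def
  proof (intro conjI ballI impI)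
    show "convex hull (\<xi> ` S) \<subseteq> convex hull (\<xi> ` A)" using SA by (intro hull_mono image_mono)
    show "convex (convex hull (\<xi> ` S))" by simp
    fix x y p assume x: "x \<in> convex hull (\<xi> ` A)" and y: "y \<in> convex hull (\<xi> ` A)"
      and p: "p \<in> convex hull (\<xi> ` S)" "p \<in> open_segment x y"
    obtain \<alpha> where \<alpha>: "\<forall>i\<in>A. 0 \<le> \<alpha> i" "sum \<alpha> A = 1" "x = (\<Sum>i\<in>A. \<alpha> i *\<^sub>R \<xi> i)"
      using x convex_hull_subfamily[OF A order_refl, of _ \<xi>] by blast
    obtain \<beta> where \<beta>: "\<forall>i\<in>A. 0 \<le> \<beta> i" "sum \<beta> A = 1" "y = (\<Sum>i\<in>A. \<beta> i *\<^sub>R \<xi> i)"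
      using y convex_hull_subfamily[OF A order_refl, of _ \<xi>] by blast
    obtain \<sigma> where \<sigma>: "\<forall>i\<in>A-S. \<sigma> i = 0" "sum \<sigma> A = 1" "p = (\<Sum>i\<in>A. \<sigma> i *\<^sub>R \<xi> i)"
      using p(1) hull by blast
    obtain t where t: "0 < t" "t < 1" "p = (1 - t) *\<^sub>R x + t *\<^sub>R y"
      using p(2) by (auto simp: in_segment)
    define a where "a i = (1 - t) * \<alpha> i + t * \<beta> i - \<sigma> i" for i
    have 0: "a i = 0" if "i \<in> A - S" for i
    proof (rule vanish[OF _ _ _ that])
      show "sum a A = 0"
        using \<alpha>(2) \<beta>(2) \<sigma>(2) by (simp add: a_def sum.distrib sum_subtractf flip: sum_distrib_left)
      have "(\<Sum>i\<in>A. a i *\<^sub>R \<xi> i) = (1 - t) *\<^sub>R x + t *\<^sub>R y - p"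
        unfolding \<alpha>(3) \<beta>(3) \<sigma>(3) a_def
        by (simp add: scaleR_sum_right sum.distrib sum_subtractf scaleR_left_distrib scaleR_left_diff_distrib)
      then show "(\<Sum>i\<in>A. a i *\<^sub>R \<xi> i) = 0" using t(3) by simp
      show "0 \<le> a i" if "i \<in> A - S" for i
        using that \<alpha>(1) \<beta>(1) \<sigma>(1) t by (simp add: a_def)
    qed
    have "\<alpha> i = 0 \<and> \<beta> i = 0" if i: "i \<in> A - S" for i
    proof -
      have "(1 - t) * \<alpha> i + t * \<beta> i = 0" using 0[OF i] \<sigma>(1) i by (simp add: a_def)
      moreover have "0 \<le> (1 - t) * \<alpha> i" "0 \<le> t * \<beta> i" using \<alpha>(1) \<beta>(1) t i by simp_all
      ultimately have "(1 - t) * \<alpha> i = 0" "t * \<beta> i = 0" by linarith+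
      then show ?thesis using t by simp
    qed
    then show "x \<in> convex hull (\<xi> ` S)" "y \<in> convex hull (\<xi> ` S)"
      using \<alpha> \<beta> unfolding hull by blast+
  qed
  have "j \<in> S" if j: "j \<in> A" "\<xi> j \<in> convex hull (\<xi> ` S)" for j
  proof (rule ccontr)
    assume nj: "j \<notin> S"
    obtain \<sigma> where \<sigma>: "\<forall>i\<in>A-S. \<sigma> i = 0" "sum \<sigma> A = 1" "\<xi> j = (\<Sum>i\<in>A. \<sigma> i *\<^sub>R \<xi> i)"
      using j(2) hull by blast
    define a where "a i = (if i = j then 1 else 0) - \<sigma> i" for i
    have "(\<Sum>i\<in>A. (if i = j then 1 else 0) *\<^sub>R \<xi> i) = (\<Sum>i\<in>A. if i = j then \<xi> i else 0)"
      by (intro sum.cong) auto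
    then have "(\<Sum>i\<in>A. (if i = j then 1 else 0) *\<^sub>R \<xi> i) = \<xi> j" using A j(1) by simp
    then have "(\<Sum>i\<in>A. a i *\<^sub>R \<xi> i) = 0"
      using \<sigma>(3) by (simp add: a_def sum_subtractf scaleR_left_diff_distrib)
    moreover have "sum a A = 0" using A j(1) \<sigma>(2) by (simp add: a_def sum_subtractf)
    moreover have "0 \<le> a i" if "i \<in> A - S" for i using \<sigma>(1) that by (simp add: a_def)
    ultimately have "a j = 0" using j(1) nj by (intro vanish[of a]) auto
    then show False using \<sigma>(1) j(1) nj by (simp add: a_def)
  qed
  then show "{i\<in>A. \<xi> i \<in> convex hull (\<xi> ` S)} = S" using SA by (auto intro: hull_inc)
qed

text \<open>A face of the hull is recovered from the generators it contains as their convex hull.\<close>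
theorem face_lattice_of_convex_hull:
  fixes \<xi> :: "'i \<Rightarrow> 'v::euclidean_space"
  assumes A: "finite A"
  shows "inclusion_isomorphic {F. F face_of convex hull (\<xi> ` A)} {S. face_index_set A \<xi> S}"
proof -
  let ?\<phi> = "\<lambda>F. {i\<in>A. \<xi> i \<in> F}"
  have hull: "F = convex hull (\<xi> ` ?\<phi> F)" if F: "F face_of convex hull (\<xi> ` A)" for F
  proof
    obtain T where T: "T \<subseteq> \<xi> ` A" "F = convex hull T"
      using face_of_convex_hull_subset[OF finite_imp_compact F] A by blast
    have "T \<subseteq> F" unfolding T(2) by (rule hull_subset)
    then have "T \<subseteq> \<xi> ` ?\<phi> F" using T(1) by blast
    then show "F \<subseteq> convex hull (\<xi> ` ?\<phi> F)" by (subst T(2)) (rule hull_mono)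
    show "convex hull (\<xi> ` ?\<phi> F) \<subseteq> F"
      by (rule hull_minimal) (use face_of_imp_convex[OF F] in auto)
  qed
  have mono: "F \<subseteq> G \<longleftrightarrow> ?\<phi> F \<subseteq> ?\<phi> G"
    if "F face_of convex hull (\<xi> ` A)" "G face_of convex hull (\<xi> ` A)" for F G
  proof
    assume "?\<phi> F \<subseteq> ?\<phi> G"
    then have "convex hull (\<xi> ` ?\<phi> F) \<subseteq> convex hull (\<xi> ` ?\<phi> G)" by (intro hull_mono image_mono)
    then show "F \<subseteq> G" using hull[OF that(1)] hull[OF that(2)] by simp
  qed blast
  have "bij_betw ?\<phi> {F. F face_of convex hull (\<xi> ` A)} {S. face_index_set A \<xi> S}"
    unfolding bij_betw_def
  proof
    show "inj_on ?\<phi> {F. F face_of convex hull (\<xi> ` A)}"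
    proof (rule inj_onI, clarify)
      fix F G assume "F face_of convex hull (\<xi> ` A)" "G face_of convex hull (\<xi> ` A)" "?\<phi> F = ?\<phi> G"
      then show "F = G" using hull by metis
    qed
    show "?\<phi> ` {F. F face_of convex hull (\<xi> ` A)} = {S. face_index_set A \<xi> S}"
    proof (intro subset_antisym subsetI)
      fix S assume "S \<in> {S. face_index_set A \<xi> S}"
      then have "convex hull (\<xi> ` S) face_of convex hull (\<xi> ` A)" "?\<phi> (convex hull (\<xi> ` S)) = S"
        using face_index_set_imp_face[OF A] by blast+
      then show "S \<in> ?\<phi> ` {F. F face_of convex hull (\<xi> ` A)}"
        by (intro image_eqI[of _ _ "convex hull (\<xi> ` S)"]) simp_all
    qed (use face_imp_face_index_set[OF A] in blast)
  qed
  then show ?thesis unfolding inclusion_isomorphic_def using mono by blast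
qed

section \<open>Block families\<close>

text \<open>The face lattice of a pyramid (iterated once for each point outside the blocks) over a free sum of
simplices, one simplex for each block: a set of vertices spans a face iff it contains all blocks or
no block.\<close>
definition block_family :: "'i set \<Rightarrow> 'i set set \<Rightarrow> 'i set set" where
  "block_family A \<B> = {S. S \<subseteq> A \<and> (\<Union>\<B> \<subseteq> S \<or> (\<forall>B\<in>\<B>. \<not> B \<subseteq> S))}"

definition block_system :: "'i set \<Rightarrow> 'i set set \<Rightarrow> bool" where
  "block_system A \<B> \<longleftrightarrow> finite A \<and> (\<forall>B\<in>\<B>. B \<subseteq> A \<and> 2 \<le> card B) \<and> disjoint \<B> \<and> 2 \<le> card \<B>"

lemma block_nonempty: "block_system A \<B> \<Longrightarrow> B \<in> \<B> \<Longrightarrow> B \<noteq> {}"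
  by (auto simp: block_system_def)

lemma disjoint_blocks:
  "block_system A \<B> \<Longrightarrow> B \<in> \<B> \<Longrightarrow> B' \<in> \<B> \<Longrightarrow> B \<noteq> B' \<Longrightarrow> B \<inter> B' = {}"
  unfolding block_system_def disjoint_def by blast

lemma other_block:
  assumes "block_system A \<B>" "B \<in> \<B>"
  obtains B' where "B' \<in> \<B>" "B' \<noteq> B" "B' \<inter> B = {}"
proof -
  have "\<not> \<B> \<subseteq> {B}"
    using assms card_mono[of "{B}" \<B>] by (auto simp: block_system_def)
  then obtain B' where "B' \<in> \<B>" "B' \<noteq> B" by blast
  then show ?thesis using that disjoint_blocks[OF assms(1) _ assms(2)] by blast
qed

lemma block_not_in_family:
  assumes "block_system A \<B>" "B \<in> \<B>"
  shows "B \<notin> block_family A \<B>"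
proof
  assume "B \<in> block_family A \<B>"
  then have "\<Union>\<B> \<subseteq> B" using assms(2) by (auto simp: block_family_def)
  moreover obtain B' where "B' \<in> \<B>" "B' \<inter> B = {}" using other_block[OF assms] by metis
  ultimately show False using block_nonempty[OF assms(1)] by blast
qed

text \<open>This recovers the blocks from the family. It uses that there are at least two nonempty disjoint blocks,
so that a single block does not contain their union.\<close>
lemma blocks_are_minimal_nonmembers:
  assumes bs: "block_system A \<B>"
  shows "B \<in> \<B> \<longleftrightarrow> B \<subseteq> A \<and> B \<notin> block_family A \<B> \<and> (\<forall>S. S \<subset> B \<longrightarrow> S \<in> block_family A \<B>)"
proof (intro iffI conjI allI impI)
  assume B: "B \<in> \<B>"
  then show BA: "B \<subseteq> A" using bs by (auto simp: block_system_def)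
  show "B \<notin> block_family A \<B>" using block_not_in_family[OF bs B] .
  fix S assume S: "S \<subset> B"
  have "\<not> B' \<subseteq> S" if "B' \<in> \<B>" for B'
  proof
    assume "B' \<subseteq> S"
    then have "B' \<noteq> B" "B' \<subseteq> B" using S by auto
    moreover have "B' \<inter> B = {} \<or> B' = B"
      using disjoint_blocks[OF bs that B] by blast
    ultimately show False using block_nonempty[OF bs that] by blast
  qed
  then show "S \<in> block_family A \<B>" using S BA by (auto simp: block_family_def)
next
  assume B: "B \<subseteq> A \<and> B \<notin> block_family A \<B> \<and> (\<forall>S. S \<subset> B \<longrightarrow> S \<in> block_family A \<B>)"
  then obtain B0 where B0: "B0 \<in> \<B>" "B0 \<subseteq> B" by (auto simp: block_family_def)
  then have "\<not> B0 \<subset> B" using B block_not_in_family[OF bs] by blast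
  then show "B \<in> \<B>" using B0 by blast
qed

lemma singleton_in_block_family:
  assumes bs: "block_system A \<B>" and x: "x \<in> A"
  shows "{x} \<in> block_family A \<B>"
proof -
  have "\<not> B \<subseteq> {x}" if "B \<in> \<B>" for B
    using card_mono[of "{x}" B] bs that by (auto simp: block_system_def)
  then show ?thesis using x by (auto simp: block_family_def)
qed

lemma empty_in_block_family:
  assumes bs: "block_system A \<B>"
  shows "{} \<in> block_family A \<B>"
  using block_nonempty[OF bs] by (auto simp: block_family_def)

text \<open>Blocks of size at least two make the singletons members of the family. They are its atoms, so an
isomorphism maps atoms to atoms, and a member is the union of the atoms below it.\<close>
lemma block_family_isomorphism_induced_by_points:
  assumes bs: "block_system A \<B>" and bs': "block_system A' \<B>'"
    and \<phi>: "bij_betw \<phi> (block_family A \<B>) (block_family A' \<B>')"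
    and mono: "\<And>S T. S \<in> block_family A \<B> \<Longrightarrow> T \<in> block_family A \<B> \<Longrightarrow> S \<subseteq> T \<longleftrightarrow> \<phi> S \<subseteq> \<phi> T"
  shows "\<exists>h. bij_betw h A A' \<and> (\<forall>S\<in>block_family A \<B>. \<phi> S = h ` S)"
proof -
  let ?F = "block_family A \<B>" and ?F' = "block_family A' \<B>'"
  have onto: "\<exists>S\<in>?F. \<phi> S = S'" if "S' \<in> ?F'" for S'
  proof -
    have "S' \<in> \<phi> ` ?F" using that bij_betw_imp_surj_on[OF \<phi>] by simp
    then show ?thesis by (metis imageE)
  qed
  have into: "\<phi> S \<in> ?F'" if "S \<in> ?F" for S using \<phi> that by (rule bij_betw_apply)
  have sub: "S' \<subseteq> A'" if "S' \<in> ?F'" for S' using that by (simp add: block_family_def)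
  have "\<phi> {} = {}"
  proof -
    obtain S where "S \<in> ?F" "\<phi> S = {}" using onto[OF empty_in_block_family[OF bs']] by blast
    then show ?thesis using mono[OF empty_in_block_family[OF bs], of S] by auto
  qed
  have sing: "\<exists>y\<in>A'. \<phi> {x} = {y}" if x: "x \<in> A" for x
  proof -
    note xF = singleton_in_block_family[OF bs x]
    have "\<phi> {x} \<noteq> {}"
      using mono[OF xF empty_in_block_family[OF bs]] \<open>\<phi> {} = {}\<close> by auto
    then obtain y where y: "y \<in> \<phi> {x}" by blast
    then have yA: "y \<in> A'" using sub[OF into[OF xF]] by blast
    obtain S where S: "S \<in> ?F" "\<phi> S = {y}"
      using onto[OF singleton_in_block_family[OF bs' yA]] by blast
    then have "S \<subseteq> {x}" using mono[OF S(1) xF] y by simp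
    moreover have "S \<noteq> {}" using S(2) \<open>\<phi> {} = {}\<close> by auto
    ultimately have "S = {x}" by blast
    then show ?thesis using S(2) yA by blast
  qed
  then obtain h where h: "\<And>x. x \<in> A \<Longrightarrow> h x \<in> A' \<and> \<phi> {x} = {h x}" by metis
  have "inj_on h A"
  proof (rule inj_onI)
    fix x y assume "x \<in> A" "y \<in> A" "h x = h y"
    then have "{x} \<subseteq> {y}"
      using mono[OF singleton_in_block_family[OF bs] singleton_in_block_family[OF bs]] h by simp
    then show "x = y" by simp
  qed
  have point: "y \<in> \<phi> S \<longleftrightarrow> y \<in> h ` S" if S: "S \<in> ?F" and y: "y \<in> A'" for S y
  proof -
    obtain T where T: "T \<in> ?F" "\<phi> T = {y}"
      using onto[OF singleton_in_block_family[OF bs' y]] by blast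
    have "T \<noteq> {}" using T(2) \<open>\<phi> {} = {}\<close> by auto
    then obtain x where x: "x \<in> T" by blast
    then have xA: "x \<in> A" using T(1) by (auto simp: block_family_def)
    have "\<phi> {x} \<subseteq> {y}"
      using mono[OF singleton_in_block_family[OF bs xA] T(1)] x T(2) by simp
    then have hx: "h x = y" using h[OF xA] by simp
    have "y \<in> \<phi> S \<longleftrightarrow> x \<in> S"
      using mono[OF singleton_in_block_family[OF bs xA] S] h[OF xA] hx by simp
    also have "\<dots> \<longleftrightarrow> y \<in> h ` S"
      using \<open>inj_on h A\<close> xA S hx inj_on_image_mem_iff[of h A x S] by (auto simp: block_family_def)
    finally show ?thesis .
  qed
  have eq: "\<phi> S = h ` S" if S: "S \<in> ?F" for S
  proof -
    have "S \<subseteq> A" using S by (simp add: block_family_def)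
    then show ?thesis using point[OF S] sub[OF into[OF S]] h by blast
  qed
  have "h ` A = A'"
  proof
    show "A' \<subseteq> h ` A"
    proof
      fix y assume y: "y \<in> A'"
      obtain T where T: "T \<in> ?F" "\<phi> T = {y}"
        using onto[OF singleton_in_block_family[OF bs' y]] by blast
      then have "y \<in> h ` T" using eq by simp
      then show "y \<in> h ` A" using T(1) by (auto simp: block_family_def)
    qed
  qed (use h in blast)
  then show ?thesis using \<open>inj_on h A\<close> eq by (auto simp: bij_betw_def)
qed

lemma Pow_image_eq:
  assumes h: "bij_betw h A A'" and S': "S' \<subseteq> A'"
  obtains S where "S \<subseteq> A" "S' = h ` S"
  using assms by (metis bij_betw_def subset_imageE)

lemma block_family_isomorphic_iff:
  assumes bs: "block_system A \<B>" and bs': "block_system A' \<B>'"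
  shows "inclusion_isomorphic (block_family A \<B>) (block_family A' \<B>') \<longleftrightarrow>
    (\<exists>h. bij_betw h A A' \<and> (`) h ` \<B> = \<B>')"
proof
  let ?F = "block_family A \<B>" and ?F' = "block_family A' \<B>'"
  assume "inclusion_isomorphic ?F ?F'"
  then obtain \<phi> where \<phi>: "bij_betw \<phi> ?F ?F'" "\<And>S T. S \<in> ?F \<Longrightarrow> T \<in> ?F \<Longrightarrow> S \<subseteq> T \<longleftrightarrow> \<phi> S \<subseteq> \<phi> T"
    by (auto simp: inclusion_isomorphic_def)
  obtain h where h0: "bij_betw h A A' \<and> (\<forall>S\<in>?F. \<phi> S = h ` S)"
    using block_family_isomorphism_induced_by_points[OF bs bs' \<phi>] ..
  have h: "bij_betw h A A'" "\<And>S. S \<in> ?F \<Longrightarrow> \<phi> S = h ` S"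
    using h0 by simp_all
  have inj: "inj_on h A" and hA: "h ` A = A'" using h(1) by (auto simp: bij_betw_def)
  have mem: "S \<in> ?F \<longleftrightarrow> h ` S \<in> ?F'" if S: "S \<subseteq> A" for S
  proof
    assume "S \<in> ?F" then show "h ` S \<in> ?F'" using h(2) bij_betw_apply[OF \<phi>(1)] by metis
  next
    assume "h ` S \<in> ?F'"
    then have "h ` S \<in> \<phi> ` ?F" by (simp add: bij_betw_imp_surj_on[OF \<phi>(1)])
    then obtain T where T: "T \<in> ?F" "\<phi> T = h ` S" by (metis imageE)
    then have "h ` T = h ` S" "T \<subseteq> A" using h(2) by (auto simp: block_family_def)
    then have "T = S" using inj_on_image_eq_iff[OF inj] S by blast
    then show "S \<in> ?F" using T by simp
  qed
  have "B \<in> \<B> \<longleftrightarrow> h ` B \<in> \<B>'" if B: "B \<subseteq> A" for B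
  proof -
    have "(\<forall>S. S \<subset> B \<longrightarrow> S \<in> ?F) \<longleftrightarrow> (\<forall>S. S \<subset> h ` B \<longrightarrow> S \<in> ?F')"
    proof (intro iffI allI impI)
      fix S assume all: "\<forall>S. S \<subset> B \<longrightarrow> S \<in> ?F" and S: "S \<subset> h ` B"
      then obtain T where T: "T \<subseteq> B" "S = h ` T" by (meson psubset_imp_subset subset_imageE)
      then have "T \<subset> B" using S by blast
      then show "S \<in> ?F'" using all mem[of T] T B by blast
    next
      fix S assume all: "\<forall>S. S \<subset> h ` B \<longrightarrow> S \<in> ?F'" and S: "S \<subset> B"
      then have "S \<subseteq> A" "\<not> B \<subseteq> S" using B by auto
      then have "\<not> h ` B \<subseteq> h ` S" using inj_on_image_subset_iff[OF inj B] by simp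
      then have "h ` S \<subset> h ` B" using S by blast
      then show "S \<in> ?F" using all mem[of S] S B by blast
    qed
    moreover have "h ` B \<subseteq> A'" using B hA by blast
    ultimately show ?thesis
      using blocks_are_minimal_nonmembers[OF bs, of B] blocks_are_minimal_nonmembers[OF bs', of "h ` B"]
        mem[OF B] B by simp
  qed
  then have blk: "B \<in> \<B> \<longleftrightarrow> h ` B \<in> \<B>'" if "B \<subseteq> A" for B using that .
  have "(`) h ` \<B> = \<B>'"
  proof
    show "(`) h ` \<B> \<subseteq> \<B>'" using blk bs by (auto simp: block_system_def)
    show "\<B>' \<subseteq> (`) h ` \<B>"
    proof
      fix B' assume B': "B' \<in> \<B>'"
      then have "B' \<subseteq> A'" using bs' by (auto simp: block_system_def)
      then obtain B where "B \<subseteq> A" "B' = h ` B" using Pow_image_eq[OF h(1)] by blast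
      then show "B' \<in> (`) h ` \<B>" using blk B' by blast
    qed
  qed
  then show "\<exists>h. bij_betw h A A' \<and> (`) h ` \<B> = \<B>'" using h(1) by blast
next
  let ?F = "block_family A \<B>" and ?F' = "block_family A' \<B>'"
  assume "\<exists>h. bij_betw h A A' \<and> (`) h ` \<B> = \<B>'"
  then obtain h where h: "bij_betw h A A'" "(`) h ` \<B> = \<B>'" by blast
  have inj: "inj_on h A" and hA: "h ` A = A'" using h(1) by (auto simp: bij_betw_def)
  have sub: "h ` S \<subseteq> h ` T \<longleftrightarrow> S \<subseteq> T" if "S \<subseteq> A" "T \<subseteq> A" for S T
    using inj_on_image_subset_iff[OF inj that] .
  have BA: "B \<subseteq> A" if "B \<in> \<B>" for B using that bs by (auto simp: block_system_def)
  have U: "\<Union>\<B>' = h ` \<Union>\<B>" unfolding h(2)[symmetric] by blast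
  have UA: "\<Union>\<B> \<subseteq> A" using BA by blast
  have mem: "h ` S \<in> ?F' \<longleftrightarrow> S \<in> ?F" if S: "S \<subseteq> A" for S
  proof -
    have "(\<forall>B'\<in>\<B>'. \<not> B' \<subseteq> h ` S) \<longleftrightarrow> (\<forall>B\<in>\<B>. \<not> h ` B \<subseteq> h ` S)"
      unfolding h(2)[symmetric] by blast
    also have "\<dots> \<longleftrightarrow> (\<forall>B\<in>\<B>. \<not> B \<subseteq> S)" using sub[OF BA S] by blast
    finally show ?thesis
      using sub[OF UA S] S hA unfolding block_family_def U by auto
  qed
  have "bij_betw ((`) h) ?F ?F'"
    unfolding bij_betw_def
  proof
    have "?F \<subseteq> Pow A" by (auto simp: block_family_def)
    then show "inj_on ((`) h) ?F" using inj_on_image_Pow[OF inj] inj_on_subset by blast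
    show "(`) h ` ?F = ?F'"
    proof (intro subset_antisym subsetI)
      fix S' assume S': "S' \<in> ?F'"
      then have "S' \<subseteq> A'" by (simp add: block_family_def)
      then obtain S where "S \<subseteq> A" "S' = h ` S" using Pow_image_eq[OF h(1)] by blast
      then show "S' \<in> (`) h ` ?F" using mem S' by blast
    next
      fix S' assume "S' \<in> (`) h ` ?F"
      then obtain S where "S \<in> ?F" "S' = h ` S" by blast
      then show "S' \<in> ?F'" using mem[of S] by (simp add: block_family_def)
    qed
  qed
  moreover have "S \<subseteq> T \<longleftrightarrow> h ` S \<subseteq> h ` T" if "S \<in> ?F" "T \<in> ?F" for S T
    using sub[of S T] that by (simp add: block_family_def)
  ultimately show "inclusion_isomorphic ?F ?F'" unfolding inclusion_isomorphic_def by blast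
qed

section \<open>The blocks of a coloured family\<close>

text \<open>The supports of the positive and of the negative part of the affine circuits, for class sizes
\<open>m1 \<le> m2 \<le> m3\<close>. An affine dependency is constant on the classes, say with values
\<open>b1, b2, b3\<close>, where \<open>b1 + b2 + b3 = 0\<close> and \<open>m1 * b1 + m2 * b2 + m3 * b3 = 0\<close>.
Unless the sizes are all equal, it is a multiple of \<open>(m3 - m2, m1 - m3, m2 - m1)\<close>, so class
\<open>2\<close> is opposite to classes \<open>1\<close> and \<open>3\<close>, and a class is absent if the two
others have the same size. If all sizes are equal, the second equation is redundant and the three
classes are mutually opposite.\<close>
definition circuit_blocks :: "(nat \<Rightarrow> 'i set) \<Rightarrow> 'i set set" where
  "circuit_blocks C =
     (if card (C 1) = card (C 2)
      then if card (C 2) = card (C 3) then {C 1, C 2, C 3} else {C 1, C 2}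
      else if card (C 2) = card (C 3) then {C 2, C 3} else {C 2, C 1 \<union> C 3})"

definition ordered_tripartition :: "'i set \<Rightarrow> (nat \<Rightarrow> 'i set) \<Rightarrow> bool" where
  "ordered_tripartition A C \<longleftrightarrow> finite A \<and> A = C 1 \<union> C 2 \<union> C 3 \<and>
     C 1 \<inter> C 2 = {} \<and> C 1 \<inter> C 3 = {} \<and> C 2 \<inter> C 3 = {} \<and>
     2 \<le> card (C 1) \<and> card (C 1) \<le> card (C 2) \<and> card (C 2) \<le> card (C 3)"

text \<open>Here \<open>s1\<close>, \<open>s2\<close>, \<open>s3\<close> say which of the three classes are contained in the
index set of a prospective face; the coefficient of a class is constrained unless the class is
contained.\<close>
lemma circuit_sign_condition:
  fixes m1 m2 m3 :: real
  assumes m: "0 < m1" "m1 \<le> m2" "m2 \<le> m3"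
  shows "(\<forall>b1 b2 b3. b1 + b2 + b3 = 0 \<longrightarrow> m1 * b1 + m2 * b2 + m3 * b3 = 0 \<longrightarrow>
            (\<not> s1 \<longrightarrow> 0 \<le> b1) \<and> (\<not> s2 \<longrightarrow> 0 \<le> b2) \<and> (\<not> s3 \<longrightarrow> 0 \<le> b3) \<longrightarrow>
            (\<not> s1 \<longrightarrow> b1 = 0) \<and> (\<not> s2 \<longrightarrow> b2 = 0) \<and> (\<not> s3 \<longrightarrow> b3 = 0)) \<longleftrightarrow>
         (if m1 = m2
          then if m2 = m3 then (s1 \<and> s2 \<and> s3) \<or> (\<not> s1 \<and> \<not> s2 \<and> \<not> s3)
               else (s1 \<longleftrightarrow> s2)
          else if m2 = m3 then (s2 \<longleftrightarrow> s3)
               else (s1 \<and> s2 \<and> s3) \<or> (\<not> s2 \<and> \<not> (s1 \<and> s3)))"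
    (is "(\<forall>b1 b2 b3. ?cond b1 b2 b3) \<longleftrightarrow> ?R")
proof
  assume all: "\<forall>b1 b2 b3. ?cond b1 b2 b3"
  let ?w1 = "m3 - m2" and ?w2 = "m1 - m3" and ?w3 = "m2 - m1"
  have w: "m1 * ?w1 + m2 * ?w2 + m3 * ?w3 = 0" "m1 * (- ?w1) + m2 * (- ?w2) + m3 * (- ?w3) = 0"
    by (simp_all add: algebra_simps)
  \<comment> \<open>For unequal sizes the circuit and its negative detect every failure; for equal sizes differences of two classes do.\<close>
  have z: "?w1 + ?w2 + ?w3 = 0" "- ?w1 + - ?w2 + - ?w3 = 0" by simp_all
  have "?cond ?w1 ?w2 ?w3" "?cond (- ?w1) (- ?w2) (- ?w3)" using all by blast+
  note p = this(1)[THEN mp, OF z(1), THEN mp, OF w(1)] and n = this(2)[THEN mp, OF z(2), THEN mp, OF w(2)]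
  have q: "?cond 1 (-1) 0" "?cond (-1) 1 0" "?cond 1 0 (-1)" "?cond (-1) 0 1" "?cond 0 1 (-1)" "?cond 0 (-1) 1"
    using all by blast+
  consider "m1 = m2" "m2 = m3" | "m1 = m2" "m2 < m3" | "m1 < m2" "m2 = m3" | "m1 < m2" "m2 < m3"
    using m by linarith
  then show ?R
  proof cases
    case 1
    then show ?thesis using q by (cases s1; cases s2; cases s3) simp_all
  next
    case 2
    then show ?thesis using p n by (cases s1; cases s2) simp_all
  next
    case 3
    then show ?thesis using p n by (cases s2; cases s3) simp_all
  next
    case 4
    then show ?thesis using p n by (cases s1; cases s2; cases s3) simp_all
  qed
next
  assume R: ?R
  show "\<forall>b1 b2 b3. ?cond b1 b2 b3"
  proof (intro allI impI)
    fix b1 b2 b3 :: real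
    assume b: "b1 + b2 + b3 = 0" "m1 * b1 + m2 * b2 + m3 * b3 = 0"
      "(\<not> s1 \<longrightarrow> 0 \<le> b1) \<and> (\<not> s2 \<longrightarrow> 0 \<le> b2) \<and> (\<not> s3 \<longrightarrow> 0 \<le> b3)"
    have b1: "b1 = - b2 - b3" using b(1) by simp
    have e: "(m2 - m1) * b2 + (m3 - m1) * b3 = 0" using b(2) unfolding b1 by (simp add: algebra_simps)
    have b2: "b2 = - b1 - b3" using b(1) by simp
    have e2: "(m2 - m1) * b1 = (m3 - m2) * b3" using b(2) unfolding b2 by (simp add: algebra_simps)
    show "(\<not> s1 \<longrightarrow> b1 = 0) \<and> (\<not> s2 \<longrightarrow> b2 = 0) \<and> (\<not> s3 \<longrightarrow> b3 = 0)"
    proof -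
      consider "m1 = m2" "m2 = m3" | "m1 = m2" "m2 < m3" | "m1 < m2" "m2 = m3" | "m1 < m2" "m2 < m3"
        using m by linarith
      then show ?thesis
      proof cases
        case 1
        then show ?thesis using R b by (auto; linarith)
      next
        case 2
        then have "b3 = 0" using e by simp
        then show ?thesis using R b 2 by auto
      next
        case 3
        then have "b1 = 0" using e2 by simp
        then show ?thesis using R b 3 by auto
      next
        case 4
        \<comment> \<open>The dependency is \<open>t\<close> times the circuit; nonnegativity in class \<open>2\<close> and in one of the others gives opposite signs for \<open>t\<close>.\<close>
        define t where "t = b1 / (m3 - m2)"
        have t1: "b1 = t * (m3 - m2)" using 4 by (simp add: t_def)
        have t3: "b3 = t * (m2 - m1)" using e2 4 by (simp add: t_def field_simps)
        have t2: "b2 = - t * (m3 - m1)" using b(1) t1 t3 by (simp add: algebra_simps)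
        have "t = 0" if "\<not> (s1 \<and> s2 \<and> s3)"
        proof (rule antisym)
          have s: "\<not> s2" "\<not> s1 \<or> \<not> s3" using R 4 that by auto
          then have "0 \<le> - t * (m3 - m1)" using b(3) t2 by simp
          then show "t \<le> 0" using 4 by (simp add: mult_le_0_iff)
          have "0 \<le> b1 \<or> 0 \<le> b3" using s b(3) by blast
          then show "0 \<le> t" using 4 t1 t3 by (auto simp: zero_le_mult_iff)
        qed
        then show ?thesis using t1 t2 t3 by auto
      qed
    qed
  qed
qed

lemma block_system_circuit_blocks:
  assumes "ordered_tripartition A C"
  shows "block_system A (circuit_blocks C)"
proof -
  have p: "finite A" "A = C 1 \<union> C 2 \<union> C 3" "C 1 \<inter> C 2 = {}" "C 1 \<inter> C 3 = {}" "C 2 \<inter> C 3 = {}"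
    "2 \<le> card (C 1)" "card (C 1) \<le> card (C 2)" "card (C 2) \<le> card (C 3)"
    using assms unfolding ordered_tripartition_def by blast+
  have fin: "finite (C 1)" "finite (C 2)" "finite (C 3)" using p(1) unfolding p(2) by simp_all
  have ne: "C 1 \<noteq> {}" "C 2 \<noteq> {}" "C 3 \<noteq> {}" using p(6-8) by auto
  have neq: "C 1 \<noteq> C 2" "C 1 \<noteq> C 3" "C 2 \<noteq> C 3" "C 2 \<noteq> C 1 \<union> C 3" using ne p(3-5) by blast+
  have "card (C 1) \<le> card (C 1 \<union> C 3)" using fin by (intro card_mono) auto
  then have "\<forall>B\<in>circuit_blocks C. B \<subseteq> A \<and> 2 \<le> card B"
    using p(2,6-8) by (auto simp: circuit_blocks_def)
  moreover have "disjoint (circuit_blocks C)"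
    unfolding circuit_blocks_def disjoint_def using p(3-5) by (auto split: if_splits)
  moreover have "2 \<le> card (circuit_blocks C)"
    unfolding circuit_blocks_def using neq by (auto simp: card_insert_if)
  ultimately show ?thesis using p(1) by (simp add: block_system_def)
qed

lemma block_family_circuit_blocks_iff:
  assumes "ordered_tripartition A C" and S: "S \<subseteq> A"
  shows "S \<in> block_family A (circuit_blocks C) \<longleftrightarrow>
    (\<forall>(b1::real) (b2::real) (b3::real). b1 + b2 + b3 = 0 \<longrightarrow>
       card (C 1) * b1 + card (C 2) * b2 + card (C 3) * b3 = 0 \<longrightarrow>
       (\<not> C 1 \<subseteq> S \<longrightarrow> 0 \<le> b1) \<and> (\<not> C 2 \<subseteq> S \<longrightarrow> 0 \<le> b2) \<and> (\<not> C 3 \<subseteq> S \<longrightarrow> 0 \<le> b3) \<longrightarrow>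
       (\<not> C 1 \<subseteq> S \<longrightarrow> b1 = 0) \<and> (\<not> C 2 \<subseteq> S \<longrightarrow> b2 = 0) \<and> (\<not> C 3 \<subseteq> S \<longrightarrow> b3 = 0))"
proof -
  have p: "0 < real (card (C 1))" "real (card (C 1)) \<le> card (C 2)" "real (card (C 2)) \<le> card (C 3)"
    using assms(1) by (simp_all add: ordered_tripartition_def)
  show ?thesis
    unfolding circuit_sign_condition[OF p] using S
    by (simp add: block_family_def circuit_blocks_def) blast
qed

lemma bij_betw_tripartition:
  assumes "finite X1" "finite X2" "finite X3" "finite Y1" "finite Y2" "finite Y3"
    and "card X1 = card Y1" "card X2 = card Y2" "card X3 = card Y3"
    and X: "X1 \<inter> X2 = {}" "X1 \<inter> X3 = {}" "X2 \<inter> X3 = {}"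
    and Y: "Y1 \<inter> Y2 = {}" "Y1 \<inter> Y3 = {}" "Y2 \<inter> Y3 = {}"
  shows "\<exists>h. bij_betw h (X1 \<union> X2 \<union> X3) (Y1 \<union> Y2 \<union> Y3) \<and> h ` X1 = Y1 \<and> h ` X2 = Y2 \<and> h ` X3 = Y3"
proof -
  obtain h1 where h1: "bij_betw h1 X1 Y1" using finite_same_card_bij[of X1 Y1] assms by blast
  obtain h2 where h2: "bij_betw h2 X2 Y2" using finite_same_card_bij[of X2 Y2] assms by blast
  obtain h3 where h3: "bij_betw h3 X3 Y3" using finite_same_card_bij[of X3 Y3] assms by blast
  define h where "h x = (if x \<in> X1 then h1 x else if x \<in> X2 then h2 x else h3 x)" for x
  have "\<And>x. x \<in> X1 \<Longrightarrow> h x = h1 x" "\<And>x. x \<in> X2 \<Longrightarrow> h x = h2 x" "\<And>x. x \<in> X3 \<Longrightarrow> h x = h3 x"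
    using X by (auto simp: h_def)
  then have "bij_betw h X1 Y1 = bij_betw h1 X1 Y1" "bij_betw h X2 Y2 = bij_betw h2 X2 Y2"
    "bij_betw h X3 Y3 = bij_betw h3 X3 Y3"
    by (simp_all only: bij_betw_cong[of X1 h h1] bij_betw_cong[of X2 h h2] bij_betw_cong[of X3 h h3])
  then have b: "bij_betw h X1 Y1" "bij_betw h X2 Y2" "bij_betw h X3 Y3" using h1 h2 h3 by simp_all
  have "bij_betw h (X1 \<union> X2) (Y1 \<union> Y2)" by (rule bij_betw_combine[OF b(1,2) Y(1)])
  then have "bij_betw h (X1 \<union> X2 \<union> X3) (Y1 \<union> Y2 \<union> Y3)"
    by (rule bij_betw_combine[OF _ b(3)]) (use Y in blast)
  then show ?thesis using b by (auto simp: bij_betw_def)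
qed

lemma ordered_tripartition_facts:
  assumes "ordered_tripartition E D"
  shows "finite (D 1)" "finite (D 2)" "finite (D 3)"
    "D 1 \<inter> D 2 = {}" "D 1 \<inter> D 3 = {}" "D 2 \<inter> D 3 = {}" "E = D 1 \<union> D 2 \<union> D 3"
    "2 \<le> card (D 1)" "card (D 1) \<le> card (D 2)" "card (D 2) \<le> card (D 3)"
    "card E = card (D 1) + card (D 2) + card (D 3)"
    "card (D 1 \<union> D 2) = card (D 1) + card (D 2)" "card (D 2 \<union> D 3) = card (D 2) + card (D 3)"
    "card (D 1 \<union> D 3) = card (D 1) + card (D 3)"
    "D 1 \<noteq> D 2" "D 1 \<noteq> D 3" "D 2 \<noteq> D 3"
proof -
  have p: "finite E" "E = D 1 \<union> D 2 \<union> D 3" "D 1 \<inter> D 2 = {}" "D 1 \<inter> D 3 = {}" "D 2 \<inter> D 3 = {}"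
    "2 \<le> card (D 1)" "card (D 1) \<le> card (D 2)" "card (D 2) \<le> card (D 3)"
    using assms unfolding ordered_tripartition_def by blast+
  have f: "finite (D 1)" "finite (D 2)" "finite (D 3)" using p(1) unfolding p(2) by simp_all
  have "(D 1 \<union> D 2) \<inter> D 3 = {}" using p by blast
  then have "card E = card (D 1) + card (D 2) + card (D 3)"
    unfolding p(2) using f p(3) by (simp add: card_Un_disjoint)
  moreover have "D 1 \<noteq> {}" "D 2 \<noteq> {}" using p(6-8) by auto
  then have "D 1 \<noteq> D 2" "D 1 \<noteq> D 3" "D 2 \<noteq> D 3" using p(3-5) by blast+
  ultimately show "finite (D 1)" "finite (D 2)" "finite (D 3)"
    "D 1 \<inter> D 2 = {}" "D 1 \<inter> D 3 = {}" "D 2 \<inter> D 3 = {}" "E = D 1 \<union> D 2 \<union> D 3"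
    "2 \<le> card (D 1)" "card (D 1) \<le> card (D 2)" "card (D 2) \<le> card (D 3)"
    "card E = card (D 1) + card (D 2) + card (D 3)"
    "card (D 1 \<union> D 2) = card (D 1) + card (D 2)" "card (D 2 \<union> D 3) = card (D 2) + card (D 3)"
    "card (D 1 \<union> D 3) = card (D 1) + card (D 3)"
    "D 1 \<noteq> D 2" "D 1 \<noteq> D 3" "D 2 \<noteq> D 3"
    using p f by (simp_all add: card_Un_disjoint)
qed

text \<open>Number, sizes and union of the blocks are invariant under bijections. They distinguish the four
types, except for II and III, which share the same shape and are told apart by comparing
\<open>card E\<close> with \<open>3 * card (D 2)\<close>.\<close>
lemma circuit_blocks_shape:
  assumes "ordered_tripartition E D"
  shows
  "has_type (card (D 1), card (D 2), card (D 3)) Type_I \<and> card (circuit_blocks D) = 2 \<and>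
     card ` circuit_blocks D = {card (D 2), card (D 1) + card (D 3)} \<and> card (\<Union>(circuit_blocks D)) = card E \<or>
   has_type (card (D 1), card (D 2), card (D 3)) Type_II \<and> card (circuit_blocks D) = 2 \<and>
     card ` circuit_blocks D = {card (D 2)} \<and> card (\<Union>(circuit_blocks D)) = 2 * card (D 2) \<or>
   has_type (card (D 1), card (D 2), card (D 3)) Type_III \<and> card (circuit_blocks D) = 2 \<and>
     card ` circuit_blocks D = {card (D 2)} \<and> card (\<Union>(circuit_blocks D)) = 2 * card (D 2) \<or>
   has_type (card (D 1), card (D 2), card (D 3)) Type_IV \<and> card (circuit_blocks D) = 3 \<and>
     card ` circuit_blocks D = {card (D 2)} \<and> card (\<Union>(circuit_blocks D)) = card E"
proof -
  note d = ordered_tripartition_facts[OF assms]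
  have "D 2 \<noteq> D 1 \<union> D 3" using d by auto
  moreover have "D 2 \<union> (D 1 \<union> D 3) = E" "D 1 \<union> (D 2 \<union> D 3) = E" using d(7) by auto
  moreover consider "card (D 1) = card (D 2)" "card (D 2) = card (D 3)"
    | "card (D 1) = card (D 2)" "card (D 2) < card (D 3)"
    | "card (D 1) < card (D 2)" "card (D 2) = card (D 3)"
    | "card (D 1) < card (D 2)" "card (D 2) < card (D 3)"
    using d(9,10) by linarith
  ultimately show ?thesis
    by cases (use d(8-17) in \<open>simp_all add: circuit_blocks_def\<close>)
qed

lemma same_type_iff:
  "same_type m m' \<longleftrightarrow> has_type m Type_I \<and> has_type m' Type_I \<or> has_type m Type_II \<and> has_type m' Type_II
    \<or> has_type m Type_III \<and> has_type m' Type_III \<or> has_type m Type_IV \<and> has_type m' Type_IV"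
proof
  assume "same_type m m'"
  then obtain T where "has_type m T" "has_type m' T" by (auto simp: same_type_def)
  then show "has_type m Type_I \<and> has_type m' Type_I \<or> has_type m Type_II \<and> has_type m' Type_II
    \<or> has_type m Type_III \<and> has_type m' Type_III \<or> has_type m Type_IV \<and> has_type m' Type_IV"
    by (cases T) simp_all
next
  assume "has_type m Type_I \<and> has_type m' Type_I \<or> has_type m Type_II \<and> has_type m' Type_II
    \<or> has_type m Type_III \<and> has_type m' Type_III \<or> has_type m Type_IV \<and> has_type m' Type_IV"
  then show "same_type m m'" unfolding same_type_def by blast
qed

text \<open>In type I the blocks have sizes \<open>m2 < m1 + m3\<close>, so \<open>m2\<close> is the smaller size, but
\<open>m1\<close> and \<open>m3\<close> are not determined separately. In the other types \<open>m2\<close> is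
the common block size, and with the total it determines \<open>m1\<close> and \<open>m3\<close>.\<close>
lemma circuit_blocks_bijection_iff:
  assumes A: "ordered_tripartition A C" and A': "ordered_tripartition A' C'"
  shows "(\<exists>h. bij_betw h A A' \<and> (`) h ` circuit_blocks C = circuit_blocks C') \<longleftrightarrow>
    card A = card A' \<and> same_type (card (C 1), card (C 2), card (C 3)) (card (C' 1), card (C' 2), card (C' 3))
    \<and> card (C 2) = card (C' 2)"
proof -
  note a = ordered_tripartition_facts[OF A] and a' = ordered_tripartition_facts[OF A']
  let ?m = "(card (C 1), card (C 2), card (C 3))" and ?m' = "(card (C' 1), card (C' 2), card (C' 3))"
  show ?thesis
  proof
    assume "\<exists>h. bij_betw h A A' \<and> (`) h ` circuit_blocks C = circuit_blocks C'"
    then obtain h where h: "bij_betw h A A'" "(`) h ` circuit_blocks C = circuit_blocks C'" by blast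
    have inj: "inj_on h A" using h(1) by (simp add: bij_betw_def)
    have BA: "B \<subseteq> A" if "B \<in> circuit_blocks C" for B
      using that block_system_circuit_blocks[OF A] by (auto simp: block_system_def)
    have cardB: "card (h ` B) = card B" if "B \<subseteq> A" for B
      using card_image[OF inj_on_subset[OF inj that]] .
    have c1: "card A = card A'" using bij_betw_same_card[OF h(1)] .
    have "card ` circuit_blocks C' = (\<lambda>B. card (h ` B)) ` circuit_blocks C"
      unfolding h(2)[symmetric] by (simp add: image_image)
    also have "\<dots> = card ` circuit_blocks C" using cardB[OF BA] by (intro image_cong) auto
    finally have c2: "card ` circuit_blocks C' = card ` circuit_blocks C" .
    have "inj_on ((`) h) (circuit_blocks C)"
      using inj_on_image_Pow[OF inj] by (rule inj_on_subset) (use BA in blast)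
    then have c3: "card (circuit_blocks C') = card (circuit_blocks C)"
      unfolding h(2)[symmetric] by (rule card_image)
    have "\<Union>(circuit_blocks C') = h ` \<Union>(circuit_blocks C)" unfolding h(2)[symmetric] by blast
    moreover have "\<Union>(circuit_blocks C) \<subseteq> A" using BA by blast
    ultimately have c4: "card (\<Union>(circuit_blocks C')) = card (\<Union>(circuit_blocks C))"
      using cardB by simp
    show "card A = card A' \<and> same_type ?m ?m' \<and> card (C 2) = card (C' 2)"
      using circuit_blocks_shape[OF A] circuit_blocks_shape[OF A'] c1 c2 c3 c4 a(8-11) a'(8-11)
      unfolding same_type_iff by (elim disjE conjE) (auto simp: doubleton_eq_iff)
  next
    assume R: "card A = card A' \<and> same_type ?m ?m' \<and> card (C 2) = card (C' 2)"
    show "\<exists>h. bij_betw h A A' \<and> (`) h ` circuit_blocks C = circuit_blocks C'"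
    proof (cases "has_type ?m Type_I")
      case True
      then have T': "has_type ?m' Type_I" using R unfolding same_type_iff by auto
      \<comment> \<open>Classes \<open>1\<close> and \<open>3\<close> form one block and need not be matched individually; the empty set fills the third part.\<close>
      have c: "card (C 1 \<union> C 3) = card (C' 1 \<union> C' 3)" using R a(11,14) a'(11,14) by simp
      obtain h where h: "bij_betw h (C 2 \<union> (C 1 \<union> C 3) \<union> {}) (C' 2 \<union> (C' 1 \<union> C' 3) \<union> {})"
        "h ` C 2 = C' 2" "h ` (C 1 \<union> C 3) = C' 1 \<union> C' 3"
        using bij_betw_tripartition[of "C 2" "C 1 \<union> C 3" "{}" "C' 2" "C' 1 \<union> C' 3" "{}"]
          a(1-6) a'(1-6) c R by (auto simp: Int_Un_distrib Int_commute)
      moreover have "C 2 \<union> (C 1 \<union> C 3) \<union> {} = A" "C' 2 \<union> (C' 1 \<union> C' 3) \<union> {} = A'"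
        using a(7) a'(7) by auto
      ultimately show ?thesis
        using True T' by (intro exI[of _ h]) (simp add: circuit_blocks_def)
    next
      case False
      then have c: "card (C 1) = card (C' 1)" "card (C 3) = card (C' 3)"
        using R a(11) a'(11) unfolding same_type_iff by auto
      obtain h where h: "bij_betw h (C 1 \<union> C 2 \<union> C 3) (C' 1 \<union> C' 2 \<union> C' 3)"
        "h ` C 1 = C' 1" "h ` C 2 = C' 2" "h ` C 3 = C' 3"
        using bij_betw_tripartition[of "C 1" "C 2" "C 3" "C' 1" "C' 2" "C' 3"] a(1-6) a'(1-6) c R by blast
      have c2: "card (C 2) = card (C' 2)" using R by simp
      have "card (C 1) = card (C 2) \<or> card (C 2) = card (C 3)" using False a(8-10) by auto
      then have "(`) h ` circuit_blocks C = circuit_blocks C'"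
        unfolding circuit_blocks_def c[symmetric] c2[symmetric] 
        by (cases "card (C 1) = card (C 2)"; cases "card (C 2) = card (C 3)")
           (simp_all only: image_insert image_empty h(2-4) if_True if_False simp_thms)
      then show ?thesis using h(1) unfolding a(7) a'(7) by blast
    qed
  qed
qed

section \<open>The face lattice of the face-vertex polytope\<close>

context coloured_simple_3polytope
begin

lemma ordered_tripartition_colour_classes:
  assumes "ordered_coloring P c"
  shows "ordered_tripartition (facets P) colour_class"
proof -
  have "facets P = colour_class 1 \<union> colour_class 2 \<union> colour_class 3"
    using colour_range by (auto simp: colour_class_def)
  moreover have "color_count P c i = card (colour_class i)" for i
    by (simp add: color_count_def colour_class_def)
  ultimately show ?thesis
    using assms colour_class_card_ge_2[of 1] finite_facets[OF polytope]
    by (auto simp: ordered_tripartition_def ordered_coloring_def colour_class_def)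
qed

lemma incidence_combination_component:
  fixes lab :: "'n::finite \<Rightarrow> 'a"
  shows "(\<Sum>f\<in>facets P. a f *\<^sub>R incidence_vector lab f) $ k = (\<Sum>f\<in>facs (lab k). a f)"
proof -
  have "(\<Sum>f\<in>facets P. a f *\<^sub>R incidence_vector lab f) $ k = (\<Sum>f\<in>facets P. if lab k \<in> f then a f else 0)"
    unfolding sum_component by (intro sum.cong) (auto simp: incidence_vector_def)
  also have "\<dots> = (\<Sum>f\<in>facs (lab k). a f)"
    unfolding facets_at_def using finite_facets[OF polytope] by (rule sum.inter_filter[symmetric])
  finally show ?thesis .
qed

lemma incidence_relation_iff:
  fixes lab :: "'n::finite \<Rightarrow> 'a"
  assumes lab: "vertex_labelling P lab"
  shows "(\<Sum>f\<in>facets P. a f *\<^sub>R incidence_vector lab f) = 0 \<longleftrightarrow> (\<forall>v\<in>V. (\<Sum>f\<in>facs v. a f) = 0)"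
proof -
  have "V = range lab" using lab by (simp add: vertex_labelling_def bij_betw_def)
  then show ?thesis
    unfolding vec_eq_iff incidence_combination_component by simp
qed

lemma sum_over_colour_classes:
  fixes \<beta> :: "nat \<Rightarrow> real"
  shows "(\<Sum>f\<in>facets P. \<beta> (c f)) =
    card (colour_class 1) * \<beta> 1 + card (colour_class 2) * \<beta> 2 + card (colour_class 3) * \<beta> 3"
proof -
  have "(\<Sum>f\<in>facets P. \<beta> (c f)) = (\<Sum>i\<in>{1,2,3}. \<Sum>f\<in>colour_class i. \<beta> (c f))"
    unfolding colour_class_def
    using colour_range by (intro sum.group[symmetric] finite_facets[OF polytope]) auto
  also have "\<dots> = (\<Sum>i\<in>{1,2,3}. \<Sum>f\<in>colour_class i. \<beta> i)"
    by (intro sum.cong refl) (simp add: colour_class_def)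
  finally show ?thesis by simp
qed

text \<open>By the description of the linear relations, the affine dependencies of the incidence vectors are the
triples of class coefficients treated in the sign analysis of the circuits, and a facet outside
\<open>S\<close> of a given colour exists iff the colour class is not contained in \<open>S\<close>.\<close>
lemma face_index_set_incidence_iff:
  fixes lab :: "'n::finite \<Rightarrow> 'a"
  assumes lab: "vertex_labelling P lab" and ord: "ordered_coloring P c"
  shows "{S. face_index_set (facets P) (incidence_vector lab) S} =
    block_family (facets P) (circuit_blocks colour_class)"
proof (intro set_eqI iffI; (unfold mem_Collect_eq)?)
  note tri = ordered_tripartition_colour_classes[OF ord]
  fix S
  assume fi: "face_index_set (facets P) (incidence_vector lab) S"
  then have S: "S \<subseteq> facets P" by (simp add: face_index_set_def)
  show "S \<in> block_family (facets P) (circuit_blocks colour_class)"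
    unfolding block_family_circuit_blocks_iff[OF tri S]
  proof (intro allI impI)
    fix b1 b2 b3 :: real
    assume b: "b1 + b2 + b3 = 0"
      "card (colour_class 1) * b1 + card (colour_class 2) * b2 + card (colour_class 3) * b3 = 0"
      "(\<not> colour_class 1 \<subseteq> S \<longrightarrow> 0 \<le> b1) \<and> (\<not> colour_class 2 \<subseteq> S \<longrightarrow> 0 \<le> b2) \<and> (\<not> colour_class 3 \<subseteq> S \<longrightarrow> 0 \<le> b3)"
    define \<beta> :: "nat \<Rightarrow> real" where "\<beta> i = (if i = 1 then b1 else if i = 2 then b2 else b3)" for i
    have \<beta>: "\<beta> 1 = b1" "\<beta> 2 = b2" "\<beta> 3 = b3" by (simp_all add: \<beta>_def)
    have s: "(\<Sum>f\<in>facets P. \<beta> (c f)) = 0" unfolding sum_over_colour_classes \<beta> by (rule b(2))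
    have r: "(\<Sum>f\<in>facets P. \<beta> (c f) *\<^sub>R incidence_vector lab f) = 0"
      using incidence_relation_iff[OF lab, of "\<lambda>f. \<beta> (c f)"] sum_colours_at_vertex[of _ \<beta>] b(1) \<beta> by simp
    have cover: "i \<in> {1,2,3} \<and> \<not> colour_class i \<subseteq> S" if "f \<in> facets P - S" "c f = i" for f i
      using that colour_range by (auto simp: colour_class_def)
    have "0 \<le> \<beta> (c f)" if "f \<in> facets P - S" for f
      using cover[OF that refl] b(3) \<beta> by auto
    then have z: "\<beta> (c f) = 0" if "f \<in> facets P - S" for f
      using fi s r that unfolding face_index_set_def by blast
    have "\<beta> i = 0" if "\<not> colour_class i \<subseteq> S" for i
      using that z by (auto simp: colour_class_def)
    then show "(\<not> colour_class 1 \<subseteq> S \<longrightarrow> b1 = 0) \<and> (\<not> colour_class 2 \<subseteq> S \<longrightarrow> b2 = 0) \<and> (\<not> colour_class 3 \<subseteq> S \<longrightarrow> b3 = 0)"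
      using \<beta> by metis
  qed
next
  note tri = ordered_tripartition_colour_classes[OF ord]
  fix S
  assume S0: "S \<in> block_family (facets P) (circuit_blocks colour_class)"
  then have S: "S \<subseteq> facets P" by (simp add: block_family_def)
  show "face_index_set (facets P) (incidence_vector lab) S"
    unfolding face_index_set_def
  proof (intro conjI S allI impI ballI)
    fix a :: "'a set \<Rightarrow> real" and f
    assume a: "sum a (facets P) = 0" "(\<Sum>f\<in>facets P. a f *\<^sub>R incidence_vector lab f) = 0"
      "\<forall>f\<in>facets P - S. 0 \<le> a f" and f: "f \<in> facets P - S"
    have rel: "(\<Sum>f\<in>facs v. a f) = 0" if "v \<in> V" for v
      using incidence_relation_iff[OF lab, of a] a(2) that by blast
    obtain \<beta> :: "nat \<Rightarrow> real" where \<beta>: "\<beta> 1 + \<beta> 2 + \<beta> 3 = 0" "\<And>f. f \<in> facets P \<Longrightarrow> a f = \<beta> (c f)"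
      using vertex_relation_constant_on_colours[of a, OF rel] by blast
    have "(\<Sum>f\<in>facets P. \<beta> (c f)) = 0" using a(1) \<beta>(2) by simp
    then have s: "card (colour_class 1) * \<beta> 1 + card (colour_class 2) * \<beta> 2 + card (colour_class 3) * \<beta> 3 = 0"
      unfolding sum_over_colour_classes .
    have pos: "0 \<le> \<beta> i" if ni: "\<not> colour_class i \<subseteq> S" for i
    proof -
      obtain g where g: "g \<in> facets P" "g \<notin> S" "c g = i" using ni by (auto simp: colour_class_def)
      then have "0 \<le> a g" using a(3) by blast
      then show ?thesis using \<beta>(2)[OF g(1)] g(3) by simp
    qed
    have zero: "(\<not> colour_class 1 \<subseteq> S \<longrightarrow> \<beta> 1 = 0) \<and> (\<not> colour_class 2 \<subseteq> S \<longrightarrow> \<beta> 2 = 0) \<and> (\<not> colour_class 3 \<subseteq> S \<longrightarrow> \<beta> 3 = 0)"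
      using S0[unfolded block_family_circuit_blocks_iff[OF tri S], rule_format, OF \<beta>(1) s] pos by simp
    have fP: "f \<in> facets P" using f by blast
    have "\<not> colour_class (c f) \<subseteq> S" using f by (auto simp: colour_class_def)
    then have "\<beta> (c f) = 0" using zero colour_range[OF fP] by auto
    then show "a f = 0" using \<beta>(2)[OF fP] by simp
  qed
qed

lemma face_lattice_face_vertex_polytope:
  fixes lab :: "'n::finite \<Rightarrow> 'a"
  assumes "vertex_labelling P lab" and "ordered_coloring P c"
  shows "inclusion_isomorphic {F. F face_of face_vertex_polytope P lab}
    (block_family (facets P) (circuit_blocks colour_class))"
  using face_lattice_of_convex_hull[OF finite_facets[OF polytope], of "incidence_vector lab"]
  unfolding face_index_set_incidence_iff[OF assms] face_vertex_polytope_def .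

end

section \<open>Combinatorial equivalence of face-vertex polytopes\<close>

theorem theorem5p1:
  fixes P :: "'a::euclidean_space set" and P' :: "'b::euclidean_space set"
    and lab :: "'n::finite \<Rightarrow> 'a" and lab' :: "'k::finite \<Rightarrow> 'b"
    and c :: "'a set \<Rightarrow> nat" and c' :: "'b set \<Rightarrow> nat"
  assumes "three_colorable P" and "three_colorable P'"
    and "vertex_labelling P lab" and "vertex_labelling P' lab'"
    and "ordered_coloring P c" and "ordered_coloring P' c'"
  shows "(combinatorially_equivalent (face_vertex_polytope P lab) (face_vertex_polytope P' lab')
          \<longleftrightarrow> card (facets P) = card (facets P')
            \<and> same_type (m_vec P c) (m_vec P' c')
            \<and> color_count P c 2 = color_count P' c' 2)
       \<and> (card (facets P) = card (facets P') \<longleftrightarrow> card (vertices P) = card (vertices P'))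
       \<and> (card (facets P) = card (facets P') \<longleftrightarrow> card (edges P) = card (edges P'))"
proof -
  interpret P: coloured_simple_3polytope P c
    using assms by unfold_locales (simp_all add: three_colorable_def ordered_coloring_def)
  interpret P': coloured_simple_3polytope P' c'
    using assms by unfold_locales (simp_all add: three_colorable_def ordered_coloring_def)
  let ?X = "{F. F face_of face_vertex_polytope P lab}" and ?X' = "{F. F face_of face_vertex_polytope P' lab'}"
  let ?\<B> = "circuit_blocks P.colour_class" and ?\<B>' = "circuit_blocks P'.colour_class"
  note tri = P.ordered_tripartition_colour_classes[OF assms(5)]
    P'.ordered_tripartition_colour_classes[OF assms(6)]
  note iso = P.face_lattice_face_vertex_polytope[OF assms(3,5)]
    P'.face_lattice_face_vertex_polytope[OF assms(4,6)]
  have count: "color_count P c i = card (P.colour_class i)" "color_count P' c' i = card (P'.colour_class i)" for i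
    by (simp_all add: color_count_def P.colour_class_def P'.colour_class_def)
  have "combinatorially_equivalent (face_vertex_polytope P lab) (face_vertex_polytope P' lab')
      \<longleftrightarrow> inclusion_isomorphic ?X ?X'"
    by (rule combinatorially_equivalent_iff)
  also have "\<dots> \<longleftrightarrow> inclusion_isomorphic (block_family (facets P) ?\<B>) (block_family (facets P') ?\<B>')"
    using iso by (meson inclusion_isomorphic_sym inclusion_isomorphic_trans)
  also have "\<dots> \<longleftrightarrow> (\<exists>h. bij_betw h (facets P) (facets P') \<and> (`) h ` ?\<B> = ?\<B>')"
    by (intro block_family_isomorphic_iff block_system_circuit_blocks tri)
  also have "\<dots> \<longleftrightarrow> card (facets P) = card (facets P') \<and> same_type (m_vec P c) (m_vec P' c')
      \<and> color_count P c 2 = color_count P' c' 2"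
    unfolding circuit_blocks_bijection_iff[OF tri] m_vec_def count by simp
  finally have main: "combinatorially_equivalent (face_vertex_polytope P lab) (face_vertex_polytope P' lab')
      \<longleftrightarrow> card (facets P) = card (facets P') \<and> same_type (m_vec P c) (m_vec P' c')
      \<and> color_count P c 2 = color_count P' c' 2" .
  show ?thesis
    using main P.vertices_facets_formula P'.vertices_facets_formula P.handshake P'.handshake by linarith
qed

end
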